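(* Let $\mu\ne0$ and $\sigma>0$ be constants and let $X_t=x+\mu t+\sigma B_t$, $t\ge0$, where $B$ is a standard Brownian motion and $x\in\mathbb{R}$. Then for every $a>0$ and every $y\in(0,a)$, the occupation time $C_y^a=\int_0^{\sigma_a}\mathbf{1}_{\{Y_t>y\}}\,\mathrm{d}t$ has the same law as the drawdown time $\sigma_{a-y}$.
   Context: The drawdown process of $X$ is $Y_t=\sup_{0\le s\le t}X_s-X_t$, and for $c>0$ the drawdown time is $\sigma_c=\inf\{t\ge0:Y_t\ge c\}$. *)

theory Defs
  imports "HOL-Probability.Probability"
begin

text \<open>Time is of type \<^typ>\<open>real\<close>; processes are only constrained and only used at times \<open>t \<ge> 0\<close>.
  As is usual when hitting times are considered, all paths are continuous, not just almost all;
  this is what makes the drawdown time measurable without completing the probability space.\<close>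

definition standard_brownian_motion :: "'a measure \<Rightarrow> (real \<Rightarrow> 'a \<Rightarrow> real) \<Rightarrow> bool" where
  "standard_brownian_motion M B \<longleftrightarrow>
     prob_space M \<and>
     (\<forall>t\<ge>0. B t \<in> borel_measurable M) \<and>
     (AE \<omega> in M. B 0 \<omega> = 0) \<and>
     (\<forall>(n::nat) (t::nat \<Rightarrow> real). 0 \<le> t 0 \<and> (\<forall>i<n. t i < t (Suc i)) \<longrightarrow>
        prob_space.indep_vars M (\<lambda>_. borel) (\<lambda>i \<omega>. B (t (Suc i)) \<omega> - B (t i) \<omega>) {..<n}) \<and>
     (\<forall>s t. 0 \<le> s \<and> s < t \<longrightarrow>
        distributed M lborel (\<lambda>\<omega>. B t \<omega> - B s \<omega>) (\<lambda>z. ennreal (normal_density 0 (sqrt (t - s)) z))) \<and>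
     (\<forall>\<omega>\<in>space M. continuous_on {0..} (\<lambda>t. B t \<omega>))"

definition drawdown :: "(real \<Rightarrow> 'a \<Rightarrow> real) \<Rightarrow> real \<Rightarrow> 'a \<Rightarrow> real" where
  "drawdown X t \<omega> = (SUP s\<in>{0..t}. X s \<omega>) - X t \<omega>"

text \<open>Values are extended: the infimum of the empty set is \<^term>\<open>\<infinity> :: ennreal\<close>.\<close>

definition drawdown_time :: "(real \<Rightarrow> 'a \<Rightarrow> real) \<Rightarrow> real \<Rightarrow> 'a \<Rightarrow> ennreal" where
  "drawdown_time X c \<omega> = (INF t\<in>{t. 0 \<le> t \<and> c \<le> drawdown X t \<omega>}. ennreal t)"

definition drawdown_occupation_time ::
  "(real \<Rightarrow> 'a \<Rightarrow> real) \<Rightarrow> real \<Rightarrow> real \<Rightarrow> 'a \<Rightarrow> ennreal" where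
  "drawdown_occupation_time X a y \<omega> =
     (\<integral>\<^sup>+t\<in>{t. 0 \<le> t \<and> ennreal t \<le> drawdown_time X a \<omega>}.
        indicator {t. y < drawdown X t \<omega>} t \<partial>lborel)"

end

theory Submission
  imports Defs
begin

text \<open>Sample the path at step \<open>1 / (N + 1)\<close>. The sampled drawdown is the random walk with i.i.d. steps
  reflected at \<open>0\<close>. Keep only the steps that the walk makes from levels at least \<open>y\<close>: the choice is
  predictable, so these steps are again i.i.d. with the same law, and the walk seen at those times,
  shifted by \<open>y\<close>, lies above the reflected walk driven by them, by at most the largest overshoot
  at a return to \<open>[y, \<infinity>)\<close>. Hence the number of steps spent above \<open>y\<close> before reaching \<open>a\<close>
  and the time at which the walk reaches \<open>a - y\<close> have the same law up to the largest step.
  By continuity of the paths the largest step vanishes as \<open>N \<rightarrow> \<infinity>\<close>. The small changes of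
  the levels that remain are removed by monotonicity in the levels, so no regularity of the law of
  the drawdown time is needed. Of Brownian motion the argument uses only continuous paths,
  stationary independent increments, and that the drawdown reaches every level almost surely.\<close>

section \<open>Reflected random walks\<close>

text \<open>The recursion peels off the first step, not the last, to match the splitting of an
  i.i.d. sequence into head and tail. Steps are subtracted because a rise of the path lowers its
  drawdown.\<close>

primrec reflected_walk :: "real \<Rightarrow> (nat \<Rightarrow> real) \<Rightarrow> nat \<Rightarrow> real" where
  "reflected_walk z s 0 = z"
| "reflected_walk z s (Suc k) = reflected_walk (max 0 (z - s 0)) (\<lambda>i. s (Suc i)) k"

text \<open>The cutoff \<open>n\<close> keeps the count finite and later serves as the induction
  variable.\<close>

definition walk_occupation :: "real \<Rightarrow> real \<Rightarrow> nat \<Rightarrow> real \<Rightarrow> (nat \<Rightarrow> real) \<Rightarrow> real" where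
  "walk_occupation a y n z s =
     (\<Sum>k<n. of_bool (y \<le> reflected_walk z s k \<and> (\<forall>i\<le>k. reflected_walk z s i < a)))"

lemma reflected_walk_Suc:
  "reflected_walk z s (Suc k) = max 0 (reflected_walk z s k - s k)"
proof (induction k arbitrary: z s)
  case (Suc k)
  show ?case
    by (subst reflected_walk.simps(2), subst Suc.IH, subst reflected_walk.simps(2)) (rule refl)
qed simp

lemma reflected_walk_mono:
  "z \<le> z' \<Longrightarrow> reflected_walk z s k \<le> reflected_walk z' s k"
  by (induction k arbitrary: z z' s) (auto intro: max.mono)

text \<open>This ties the walk to the drawdown. A new value either exceeds the running maximum,
  which resets the difference to 0, or leaves the maximum unchanged.\<close>

lemma reflected_walk_increments:
  "reflected_walk 0 (\<lambda>i. f (Suc i) - f i) k = Max (f ` {..k}) - f k"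
proof (induction k)
  case (Suc k)
  have "Max (f ` {..Suc k}) = max (f (Suc k)) (Max (f ` {..k}))"
    by (simp add: atMost_Suc)
  with Suc show ?case
    by (simp only: reflected_walk_Suc max_def split: if_splits) auto
qed simp

lemma all_le_Suc_shift: "(\<forall>k\<le>Suc n. P k) \<longleftrightarrow> P 0 \<and> (\<forall>k\<le>n. P (Suc k))"
proof -
  have "(\<forall>k\<in>{..Suc n}. P k) \<longleftrightarrow> P 0 \<and> (\<forall>k\<in>{..n}. P (Suc k))"
    unfolding atMost_Suc_eq_insert_0 by blast
  then show ?thesis by (simp only: Ball_def atMost_iff)
qed

text \<open>First-step recursion. From \<open>a <= z\<close> every summand vanishes, because index 0
  already violates the condition of staying below \<open>a\<close>.\<close>

lemma walk_occupation_case_nat: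
  "walk_occupation a y (Suc n) z (case_nat x s) =
     (if z < a then of_bool (y \<le> z) + walk_occupation a y n (max 0 (z - x)) s else 0)"
  unfolding walk_occupation_def
  by (simp add: sum.lessThan_Suc_shift all_le_Suc_shift del: sum.lessThan_Suc)

lemma walk_occupation_nonneg: "0 \<le> walk_occupation a y n z s"
  by (simp add: walk_occupation_def sum_nonneg)

lemma borel_measurable_reflected_walk:
  assumes [measurable]: "\<And>i. (\<lambda>x. s x i) \<in> borel_measurable M"
  shows "(\<lambda>x. reflected_walk z (s x) k) \<in> borel_measurable M"
proof (induction k)
  case (Suc k)
  then show ?case
    unfolding reflected_walk_Suc by measurable
qed simp

lemma borel_measurable_walk_occupation:
  assumes [measurable]: "\<And>i. (\<lambda>x. s x i) \<in> borel_measurable M"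
  shows "(\<lambda>x. walk_occupation a y n z (s x)) \<in> borel_measurable M"
proof -
  have [measurable]: "(\<lambda>x. reflected_walk z (s x) k) \<in> borel_measurable M" for k
    by (rule borel_measurable_reflected_walk) measurable
  show ?thesis
    unfolding walk_occupation_def by measurable
qed

text \<open>Integrality later sharpens a strict bound \<open>real m < ...\<close> to
  \<open>real (Suc m) <= ...\<close>, which compensates for the floor in
  \<open>sample_index\<close>.\<close>

lemma walk_occupation_of_nat: "\<exists>n'::nat. walk_occupation a y n z s = real n'"
proof
  show "walk_occupation a y n z s
      = real (\<Sum>k<n. of_bool (y \<le> reflected_walk z s k \<and> (\<forall>i\<le>k. reflected_walk z s i < a)))"
    by (simp add: walk_occupation_def)
qed

section \<open>First-step analysis for walks with i.i.d. steps\<close>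

locale real_sequence_space = sequence_space Q for Q :: "real measure" +
  assumes sets_Q [measurable_cong]: "sets Q = sets borel"
begin

lemma reflected_walk_measurable [measurable]:
  "(\<lambda>s. reflected_walk z s k) \<in> borel_measurable S"
  by (rule borel_measurable_reflected_walk) measurable

lemma walk_occupation_measurable [measurable]:
  "(\<lambda>s. walk_occupation a y n z s) \<in> borel_measurable S"
  by (rule borel_measurable_walk_occupation) measurable

text \<open>Prepending an independent draw from \<open>Q\<close> to a \<open>Q\<close>-sequence
  reproduces the product measure, so conditioning on the first step is Fubini's theorem.\<close>

lemma emeasure_S_first_step:
  assumes [measurable]: "Measurable.pred S P"
  shows "emeasure S {s \<in> space S. P s}
    = (\<integral>\<^sup>+x. emeasure S {s \<in> space S. P (case_nat x s)} \<partial>Q)"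
proof -
  have "emeasure S {s \<in> space S. P s}
      = emeasure (distr (Q \<Otimes>\<^sub>M S) S (\<lambda>(x, s). case_nat x s)) {s \<in> space S. P s}"
    by (simp add: PiM_iter)
  also have "\<dots> = emeasure (Q \<Otimes>\<^sub>M S)
      ((\<lambda>(x, s). case_nat x s) -` {s \<in> space S. P s} \<inter> space (Q \<Otimes>\<^sub>M S))"
    by (rule emeasure_distr) measurable
  also have "\<dots> = (\<integral>\<^sup>+x. emeasure S (Pair x -` ((\<lambda>(x, s). case_nat x s) -` {s \<in> space S. P s} \<inter> space (Q \<Otimes>\<^sub>M S))) \<partial>Q)"
    by (rule P.emeasure_pair_measure_alt) measurable
  also have "\<dots> = (\<integral>\<^sup>+x. emeasure S {s \<in> space S. P (case_nat x s)} \<partial>Q)"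
    by (rule nn_integral_cong, rule arg_cong[where f = "emeasure S"])
       (fastforce simp: space_pair_measure space_PiM PiE_def split: nat.split)
  finally show ?thesis .
qed

text \<open>Tail of the hitting time of level \<open>c\<close>, the discrete counterpart of the law
  of a drawdown time.\<close>

definition survival :: "real \<Rightarrow> nat \<Rightarrow> real \<Rightarrow> ennreal" where
  "survival c m z = emeasure S {s \<in> space S. \<forall>k\<le>m. reflected_walk z s k < c}"

lemma survival_0: "survival c 0 z = of_bool (z < c)"
  by (auto simp: survival_def P.emeasure_space_1)

lemma survival_Suc:
  "survival c (Suc m) z = (\<integral>\<^sup>+x. of_bool (z < c) * survival c m (max 0 (z - x)) \<partial>Q)"
proof -
  have "survival c (Suc m) z
      = (\<integral>\<^sup>+x. emeasure S {s \<in> space S. \<forall>k\<le>Suc m. reflected_walk z (case_nat x s) k < c} \<partial>Q)"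
    unfolding survival_def by (rule emeasure_S_first_step) measurable
  also have "\<dots> = (\<integral>\<^sup>+x. of_bool (z < c) * survival c m (max 0 (z - x)) \<partial>Q)"
    unfolding survival_def all_le_Suc_shift by (rule nn_integral_cong) simp
  finally show ?thesis .
qed

lemma survival_eq_0: "c \<le> z \<Longrightarrow> survival c m z = 0"
  by (cases m) (simp_all add: survival_0 survival_Suc)

lemma survival_antimono: "z \<le> z' \<Longrightarrow> survival c m z' \<le> survival c m z"
  unfolding survival_def
  by (rule emeasure_mono) (auto intro: le_less_trans[OF reflected_walk_mono])

lemma emeasure_S_le_1: "emeasure S A \<le> 1"
  by (rule P.emeasure_le_1)

lemma survival_le_1: "survival c m z \<le> 1"
  unfolding survival_def by (rule emeasure_S_le_1)

text \<open>One-step induction instead of an explicit coupling: the retained steps never appear, only the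
  survival probability, which decreases in the starting point.\<close>

lemma emeasure_occupation_le_survival:
  "emeasure S {s \<in> space S. real m < walk_occupation a y n z s} \<le> survival (a - y) m (max 0 (z - y))"
proof (induction n arbitrary: m z)
  case 0
  then show ?case by (simp add: walk_occupation_def)
next
  case (Suc n)
  have step: "emeasure S {s \<in> space S. real m < walk_occupation a y (Suc n) z s}
      = (\<integral>\<^sup>+x. emeasure S {s \<in> space S. real m < walk_occupation a y (Suc n) z (case_nat x s)} \<partial>Q)"
    by (rule emeasure_S_first_step) measurable
  \<comment> \<open>Already stopped; below \<open>y\<close>, where the step is discarded; at or
    above \<open>y\<close>, where the visit counts and either settles the claim or leaves one visit
    fewer to find.\<close>
  consider "a \<le> z" | "z < a" "z < y" | "z < a" "y \<le> z" "m = 0" | k where "z < a" "y \<le> z" "m = Suc k"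
    by (meson not0_implies_Suc not_le)
  then show ?case
  proof cases
    case 1
    then show ?thesis by (simp add: step walk_occupation_case_nat)
  next
    \<comment> \<open>The walk may come back above \<open>y\<close> by any amount; a comparison walk
      started at 0 has the largest survival probability.\<close>
    case 2
    have "emeasure S {s \<in> space S. real m < walk_occupation a y (Suc n) z s} \<le> (\<integral>\<^sup>+x. survival (a - y) m 0 \<partial>Q)"
      unfolding step using 2
      by (intro nn_integral_mono)
         (auto simp: walk_occupation_case_nat intro!: order.trans[OF Suc.IH] survival_antimono)
    with 2 show ?thesis by (simp add: M.emeasure_space_1)
  next
    case 3
    then show ?thesis by (simp add: survival_0 emeasure_S_le_1)
  next
    \<comment> \<open>The current visit uses up one unit of \<open>m\<close>, and its step also
      drives the comparison walk: for \<open>y <= z\<close>,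
      \<open>max 0 (max 0 (z - y) - x)\<close> is at most
      \<open>max 0 (max 0 (z - x) - y)\<close>.\<close>
    case 4
    have "emeasure S {s \<in> space S. real m < walk_occupation a y (Suc n) z s}
        \<le> (\<integral>\<^sup>+x. survival (a - y) k (max 0 (max 0 (z - y) - x)) \<partial>Q)"
      unfolding step using 4
      by (intro nn_integral_mono)
         (auto simp: walk_occupation_case_nat intro!: order.trans[OF Suc.IH] survival_antimono)
    with 4 show ?thesis by (simp add: survival_Suc)
  qed
qed

text \<open>The third alternative absorbs overshoots larger than \<open>e\<close>; the second covers the paths that have
  not reached \<open>a\<close> by time \<open>n\<close>, whose occupation count may still be short.\<close>

lemma survival_le_emeasure_occupation:
  fixes a y e :: real
  defines "E \<equiv> \<lambda>n m z s. real m < walk_occupation a y n z s \<or> (\<forall>k\<le>n. reflected_walk z s k < a)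
                        \<or> (\<exists>k<n. e < \<bar>s k\<bar>)"
  assumes "0 < e" "0 \<le> y"
  shows "survival (a - y - e) m (max 0 (z - y - e)) \<le> emeasure S {s \<in> space S. E n m z s}"
proof (induction n arbitrary: m z)
  case 0
  \<comment> \<open>Without any steps, a start below \<open>a\<close> satisfies the second
    alternative; any other start makes the left side zero.\<close>
  show ?case
  proof (cases "z < a")
    case True
    then show ?thesis by (simp add: E_def survival_le_1 P.emeasure_space_1)
  next
    case False
    then show ?thesis by (simp add: survival_eq_0)
  qed
next
  case (Suc n)
  have [measurable]: "Measurable.pred S (E n m z)" for n m z
    unfolding E_def by measurable
  have step: "emeasure S {s \<in> space S. E (Suc n) m z s}
      = (\<integral>\<^sup>+x. emeasure S {s \<in> space S. E (Suc n) m z (case_nat x s)} \<partial>Q)"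
    by (rule emeasure_S_first_step) measurable
  have E_Suc: "E (Suc n) m z (case_nat x s) \<longleftrightarrow>
     real m < (if z < a then of_bool (y \<le> z) + walk_occupation a y n (max 0 (z - x)) s else 0) \<or>
     z < a \<and> (\<forall>k\<le>n. reflected_walk (max 0 (z - x)) s k < a) \<or> e < \<bar>x\<bar> \<or> (\<exists>k<n. e < \<bar>s k\<bar>)" for x s m
    unfolding E_def all_le_Suc_shift walk_occupation_case_nat by (simp add: Ex_less_Suc2)
  consider "a \<le> z" | "z < a" "z < y" | "z < a" "y \<le> z" "m = 0" | k where "z < a" "y \<le> z" "m = Suc k"
    by (meson not0_implies_Suc not_le)
  then show ?case
  proof cases
    case 1
    then show ?thesis by (simp add: survival_eq_0)
  next
    \<comment> \<open>From below \<open>y\<close>, a step of size at most \<open>e\<close> cannot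
      carry the walk beyond \<open>y + e\<close>, so the comparison walk restarts exactly at 0; a
      larger step satisfies \<open>E\<close> outright.\<close>
    case 2
    have "survival (a - y - e) m 0 \<le> emeasure S {s \<in> space S. E (Suc n) m z (case_nat x s)}" for x
    proof (cases "e < \<bar>x\<bar>")
      case True
      then show ?thesis by (simp add: E_Suc survival_le_1 P.emeasure_space_1)
    next
      case False
      have "survival (a - y - e) m 0 \<le> survival (a - y - e) m (max 0 (max 0 (z - x) - y - e))"
        using False 2 assms(2,3) by (intro survival_antimono) linarith
      also have "\<dots> \<le> emeasure S {s \<in> space S. E n m (max 0 (z - x)) s}"
        by (rule Suc.IH)
      also have "\<dots> \<le> emeasure S {s \<in> space S. E (Suc n) m z (case_nat x s)}"
        using 2 unfolding E_Suc by (intro emeasure_mono) (auto simp: E_def)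
      finally show ?thesis .
    qed
    then have "(\<integral>\<^sup>+x. survival (a - y - e) m 0 \<partial>Q) \<le> emeasure S {s \<in> space S. E (Suc n) m z s}"
      unfolding step by (intro nn_integral_mono)
    with 2 assms(2,3) show ?thesis by (simp add: M.emeasure_space_1)
  next
    case 3
    \<comment> \<open>The present visit alone already makes the count exceed 0.\<close>
    have "E (Suc n) m z (case_nat x s)" for x s
      using 3 walk_occupation_nonneg[of a y n "max 0 (z - x)" s] by (simp add: E_Suc)
    then show ?thesis
      by (simp add: step survival_le_1 P.emeasure_space_1 M.emeasure_space_1)
  next
    \<comment> \<open>A step of any size works: \<open>max 0 (max 0 (z - x) - y - e)\<close> is at
      most \<open>max 0 (max 0 (z - y - e) - x)\<close>, since truncating \<open>z - y - e\<close>
      at 0 before the step only raises the outcome.\<close>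
    case 4
    have "survival (a - y - e) k (max 0 (max 0 (z - y - e) - x))
        \<le> emeasure S {s \<in> space S. E (Suc n) m z (case_nat x s)}" for x
    proof -
      have "survival (a - y - e) k (max 0 (max 0 (z - y - e) - x))
          \<le> survival (a - y - e) k (max 0 (max 0 (z - x) - y - e))"
        using 4 assms(2,3) by (intro survival_antimono) linarith
      also have "\<dots> \<le> emeasure S {s \<in> space S. E n k (max 0 (z - x)) s}"
        by (rule Suc.IH)
      also have "\<dots> \<le> emeasure S {s \<in> space S. E (Suc n) m z (case_nat x s)}"
        using 4 unfolding E_Suc by (intro emeasure_mono) (auto simp: E_def)
      finally show ?thesis .
    qed
    then have "(\<integral>\<^sup>+x. survival (a - y - e) k (max 0 (max 0 (z - y - e) - x)) \<partial>Q)
        \<le> emeasure S {s \<in> space S. E (Suc n) m z s}"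
      unfolding step by (intro nn_integral_mono)
    with 4 assms(2,3) show ?thesis by (simp add: survival_Suc)
  qed
qed

end

section \<open>Sampling a continuous path\<close>

text \<open>Dividing by \<open>Suc N\<close> keeps the mesh well defined for every \<open>N\<close>.
  The argument order makes \<open>sampled_increments X N\<close> a random sequence that can be
  pushed forward to a product space.\<close>

definition sampled_increments :: "(real \<Rightarrow> 'a \<Rightarrow> real) \<Rightarrow> nat \<Rightarrow> 'a \<Rightarrow> nat \<Rightarrow> real" where
  "sampled_increments X N \<omega> i = X (real (Suc i) / real (Suc N)) \<omega> - X (real i / real (Suc N)) \<omega>"

abbreviation sampled_drawdown :: "(real \<Rightarrow> 'a \<Rightarrow> real) \<Rightarrow> nat \<Rightarrow> 'a \<Rightarrow> nat \<Rightarrow> real" where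
  "sampled_drawdown X N \<omega> \<equiv> reflected_walk 0 (sampled_increments X N \<omega>)"

abbreviation sample_index :: "nat \<Rightarrow> real \<Rightarrow> nat" where
  "sample_index N t \<equiv> nat \<lfloor>t * real (Suc N)\<rfloor>"

text \<open>Stopping is phrased through the path staying below \<open>a\<close>, the same form as in
  \<open>walk_occupation\<close>. The moment of reaching \<open>a\<close> is left out, a single
  point.\<close>

definition occupied_times :: "(real \<Rightarrow> 'a \<Rightarrow> real) \<Rightarrow> real \<Rightarrow> real \<Rightarrow> 'a \<Rightarrow> real set" where
  "occupied_times X a y \<omega> = {s. 0 \<le> s \<and> (\<forall>u\<in>{0..s}. drawdown X u \<omega> < a) \<and> y < drawdown X s \<omega>}"

section \<open>Arithmetic of the sampling grid\<close>

lemma sample_index_bounds: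
  assumes "0 \<le> t"
  shows "real (sample_index N t) / real (Suc N) \<le> t" "t < real (Suc (sample_index N t)) / real (Suc N)"
proof -
  have "real (sample_index N t) = of_int \<lfloor>t * real (Suc N)\<rfloor>"
    using assms by simp
  then show "real (sample_index N t) / real (Suc N) \<le> t" "t < real (Suc (sample_index N t)) / real (Suc N)"
    using floor_correct[of "t * real (Suc N)"] by (simp_all add: field_simps)
qed

lemma sample_index_eqI:
  assumes "real k / real (Suc N) \<le> t" "t < real (Suc k) / real (Suc N)"
  shows "sample_index N t = k"
proof -
  have "\<lfloor>t * real (Suc N)\<rfloor> = int k"
    using assms by (intro floor_unique) (simp_all add: field_simps)
  then show ?thesis by simp
qed

lemma sample_index_sample [simp]: "sample_index N (real k / real (Suc N)) = k"
  by (rule sample_index_eqI) (simp_all add: field_simps)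

lemma sample_index_mono: "s \<le> t \<Longrightarrow> sample_index N s \<le> sample_index N t"
  by (intro nat_mono floor_mono mult_right_mono) auto

lemma sample_time_le:
  assumes "k \<le> sample_index N t" "0 \<le> t"
  shows "real k / real (Suc N) \<le> t"
proof -
  have "real k / real (Suc N) \<le> real (sample_index N t) / real (Suc N)"
    using assms(1) by (intro divide_right_mono of_nat_mono) auto
  also have "\<dots> \<le> t"
    using assms(2) by (rule sample_index_bounds)
  finally show ?thesis .
qed

text \<open>The condition is constant on grid cells of length \<open>1 / real (Suc N)\<close>, so
  its duration is a number of cells divided by \<open>real (Suc N)\<close>.\<close>

lemma emeasure_sampled_times:
  fixes T N :: nat
  shows "{s\<in>{0..<real T}. P (sample_index N s)} \<in> sets borel" (is "?G \<in> _")
    and "emeasure lborel {s\<in>{0..<real T}. P (sample_index N s)}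
           = ennreal ((\<Sum>k<T * Suc N. of_bool (P k)) / real (Suc N))"
proof -
  define J :: "nat \<Rightarrow> real set" where "J k = {real k / real (Suc N)..<real (Suc k) / real (Suc N)}" for k
  define K where "K = {k\<in>{..<T * Suc N}. P k}"
  have mem_J: "s \<in> J k \<longleftrightarrow> 0 \<le> s \<and> sample_index N s = k" for s k
    using sample_index_eqI[of k N s] sample_index_bounds[of s N]
    by (auto simp: J_def intro: order.trans[rotated])
  \<comment> \<open>The integer \<open>T\<close> is a grid point, so \<open>{0..<real T}\<close>
    consists of exactly \<open>T * Suc N\<close> whole cells.\<close>
  have less_T: "s < real T \<longleftrightarrow> sample_index N s < T * Suc N" if "0 \<le> s" for s
  proof -
    have "sample_index N s < T * Suc N \<longleftrightarrow> \<lfloor>s * real (Suc N)\<rfloor> < int (T * Suc N)"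
      using that by (subst nat_less_iff) auto
    also have "\<dots> \<longleftrightarrow> s * real (Suc N) < real T * real (Suc N)"
      by (subst floor_less_iff) (simp only: of_int_of_nat_eq of_nat_mult of_int_mult)
    finally show ?thesis by simp
  qed
  have G: "?G = (\<Union>k\<in>K. J k)"
    using less_T by (auto simp: mem_J K_def)
  show "?G \<in> sets borel"
    unfolding G K_def J_def by auto
  have "emeasure lborel ?G = (\<Sum>k\<in>K. emeasure lborel (J k))"
    unfolding G
    by (rule sum_emeasure[symmetric]) (auto simp: disjoint_family_on_def mem_J K_def, auto simp: J_def)
  also have "\<dots> = (\<Sum>k\<in>K. ennreal (1 / real (Suc N)))"
  proof (intro sum.cong refl)
    fix k
    have "real k / real (Suc N) \<le> real (Suc k) / real (Suc N)"
      by (intro divide_right_mono) auto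
    then have "emeasure lborel (J k) = ennreal (real (Suc k) / real (Suc N) - real k / real (Suc N))"
      unfolding J_def by (rule emeasure_lborel_Ico)
    then show "emeasure lborel (J k) = ennreal (1 / real (Suc N))"
      by (simp add: diff_divide_distrib[symmetric])
  qed
  also have "\<dots> = ennreal (\<Sum>k\<in>K. 1 / real (Suc N))"
    by (rule sum_ennreal) simp
  also have "(\<Sum>k\<in>K. 1 / real (Suc N)) = (\<Sum>k<T * Suc N. of_bool (P k)) / real (Suc N)"
    by (simp add: K_def sum_divide_distrib sum.If_cases of_bool_def Int_def)
  finally show "emeasure lborel ?G = ennreal ((\<Sum>k<T * Suc N. of_bool (P k)) / real (Suc N))" .
qed

section \<open>Drawdown of one continuous path\<close>

locale continuous_path =
  fixes X :: "real \<Rightarrow> 'a \<Rightarrow> real" and \<omega> :: 'a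
  assumes continuous_path: "continuous_on {0..} (\<lambda>t. X t \<omega>)"
begin

lemma bdd_above_path: "bdd_above ((\<lambda>s. X s \<omega>) ` {0..t})"
proof -
  have "compact ((\<lambda>s. X s \<omega>) ` {0..t})"
    by (intro compact_continuous_image continuous_on_subset[OF continuous_path]) auto
  then show ?thesis by (intro bounded_imp_bdd_above compact_imp_bounded)
qed

lemma path_uniformly_continuous:
  assumes "0 < \<epsilon>"
  obtains d where "0 < d" "\<And>u v. u \<in> {0..T} \<Longrightarrow> v \<in> {0..T} \<Longrightarrow> \<bar>u - v\<bar> < d \<Longrightarrow> \<bar>X u \<omega> - X v \<omega>\<bar> < \<epsilon>"
proof -
  have "uniformly_continuous_on {0..T} (\<lambda>t. X t \<omega>)"
    by (intro compact_uniformly_continuous continuous_on_subset[OF continuous_path]) auto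
  with assms show ?thesis
    unfolding uniformly_continuous_on_def dist_real_def using that by blast
qed

text \<open>The running supremum and the path each move by at most \<open>e\<close>, whence the
  factor 2.\<close>

lemma drawdown_oscillation:
  assumes "0 \<le> s" "s \<le> t" and osc: "\<And>u. u \<in> {s..t} \<Longrightarrow> \<bar>X u \<omega> - X s \<omega>\<bar> \<le> e"
  shows "\<bar>drawdown X t \<omega> - drawdown X s \<omega>\<bar> \<le> 2 * e"
proof -
  have "(SUP r\<in>{0..s}. X r \<omega>) \<le> (SUP r\<in>{0..t}. X r \<omega>)"
    using assms by (intro cSUP_subset_mono bdd_above_path) auto
  moreover have "(SUP r\<in>{0..t}. X r \<omega>) \<le> (SUP r\<in>{0..s}. X r \<omega>) + e"
  proof (rule cSUP_least)
    fix u assume u: "u \<in> {0..t}"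
    have *: "X v \<omega> \<le> (SUP r\<in>{0..s}. X r \<omega>)" if "v \<in> {0..s}" for v
      using that by (intro cSUP_upper bdd_above_path)
    show "X u \<omega> \<le> (SUP r\<in>{0..s}. X r \<omega>) + e"
    proof (cases "u \<le> s")
      case True
      then show ?thesis using *[of u] osc[of s] u assms by auto
    next
      case False
      with u osc[of u] have "\<bar>X u \<omega> - X s \<omega>\<bar> \<le> e" by simp
      with *[of s] assms(1) show ?thesis by (simp add: abs_le_iff)
    qed
  qed (use assms in auto)
  moreover have "\<bar>X t \<omega> - X s \<omega>\<bar> \<le> e"
    using osc[of t] assms(2) by simp
  ultimately show ?thesis
    unfolding drawdown_def by linarith
qed

lemma drawdown_uniformly_continuous:
  assumes "0 < \<epsilon>"
  obtains d where "0 < d"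
    "\<And>s t. s \<in> {0..T} \<Longrightarrow> t \<in> {0..T} \<Longrightarrow> \<bar>s - t\<bar> < d \<Longrightarrow> \<bar>drawdown X s \<omega> - drawdown X t \<omega>\<bar> < \<epsilon>"
proof -
  \<comment> \<open>One third leaves a strict margin after the factor 2 of
    \<open>drawdown_oscillation\<close>.\<close>
  obtain d where d: "0 < d"
    "\<And>u v. u \<in> {0..T} \<Longrightarrow> v \<in> {0..T} \<Longrightarrow> \<bar>u - v\<bar> < d \<Longrightarrow> \<bar>X u \<omega> - X v \<omega>\<bar> < \<epsilon> / 3"
    using path_uniformly_continuous[of "\<epsilon> / 3" T] assms by auto
  have *: "\<bar>drawdown X t \<omega> - drawdown X s \<omega>\<bar> < \<epsilon>" if "s \<in> {0..T}" "t \<in> {0..T}" "\<bar>s - t\<bar> < d" "s \<le> t" for s t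
  proof -
    have "\<bar>drawdown X t \<omega> - drawdown X s \<omega>\<bar> \<le> 2 * (\<epsilon> / 3)"
      using that d by (intro drawdown_oscillation) (auto intro!: less_imp_le)
    with assms show ?thesis by simp
  qed
  show ?thesis
  proof (rule that[OF d(1)])
    fix s t assume "s \<in> {0..T}" "t \<in> {0..T}" "\<bar>s - t\<bar> < d"
    then show "\<bar>drawdown X s \<omega> - drawdown X t \<omega>\<bar> < \<epsilon>"
      using *[of s t] *[of t s] by (cases "s \<le> t") (auto simp: abs_minus_commute)
  qed
qed

lemma continuous_on_drawdown: "continuous_on {0..} (\<lambda>t. drawdown X t \<omega>)"
  unfolding continuous_on_iff
proof (intro ballI allI impI)
  fix t \<epsilon> :: real assume t: "t \<in> {0..}" and \<epsilon>: "0 < \<epsilon>"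
  obtain d where d: "0 < d"
    "\<And>r s. r \<in> {0..t + 1} \<Longrightarrow> s \<in> {0..t + 1} \<Longrightarrow> \<bar>r - s\<bar> < d \<Longrightarrow> \<bar>drawdown X r \<omega> - drawdown X s \<omega>\<bar> < \<epsilon>"
    using drawdown_uniformly_continuous[OF \<epsilon>, of "t + 1"] by blast
  show "\<exists>d>0. \<forall>s\<in>{0..}. dist s t < d \<longrightarrow> dist (drawdown X s \<omega>) (drawdown X t \<omega>) < \<epsilon>"
    using t d by (intro exI[of _ "min d 1"]) (auto simp: dist_real_def)
qed

text \<open>Both errors come from the oscillation within one cell: moving \<open>t\<close> back to a
  grid point, and replacing the running supremum by a maximum over grid points. Uniform continuity
  makes them uniform in \<open>t\<close>.\<close>

lemma sampled_drawdown_approx: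
  assumes "0 < \<epsilon>" "0 \<le> T"
  shows "\<forall>\<^sub>F N in sequentially. \<forall>t\<in>{0..T}. \<bar>drawdown X t \<omega> - sampled_drawdown X N \<omega> (sample_index N t)\<bar> < \<epsilon>"
proof -
  \<comment> \<open>Budget: two quarters for moving \<open>t\<close> to the grid, one for the
    supremum; the fourth keeps the inequality strict.\<close>
  obtain d where d: "0 < d"
    "\<And>u v. u \<in> {0..T} \<Longrightarrow> v \<in> {0..T} \<Longrightarrow> \<bar>u - v\<bar> < d \<Longrightarrow> \<bar>X u \<omega> - X v \<omega>\<bar> < \<epsilon> / 4"
    using path_uniformly_continuous[of "\<epsilon> / 4" T] assms by auto
  have "\<forall>\<^sub>F N in sequentially. 1 / real (Suc N) < d"
    using d(1) by real_asymp
  then show ?thesis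
  proof eventually_elim
    case (elim N)
    show ?case
    proof
      fix t assume t: "t \<in> {0..T}"
      define k where "k = sample_index N t"
      define p where "p i = real i / real (Suc N)" for i
      have k: "p k \<le> t" "t < p (Suc k)" "0 \<le> p k" and p_Suc: "p (Suc i) = p i + 1 / real (Suc N)" for i
        using sample_index_bounds[of t N] t by (auto simp: k_def p_def add_divide_distrib)
      have 1: "\<bar>drawdown X t \<omega> - drawdown X (p k) \<omega>\<bar> \<le> 2 * (\<epsilon> / 4)"
      proof (rule drawdown_oscillation)
        fix u assume "u \<in> {p k..t}"
        then show "\<bar>X u \<omega> - X (p k) \<omega>\<bar> \<le> \<epsilon> / 4"
          using k t elim p_Suc[of k] by (intro less_imp_le d(2)) auto
      qed (use k in auto)
      define m where "m = Max ((\<lambda>i. X (p i) \<omega>) ` {..k})"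
      have m: "X (p i) \<omega> \<le> m" if "i \<le> k" for i
        unfolding m_def using that by (intro Max_ge) auto
      have p_mono: "p i \<le> p k" if "i \<le> k" for i
        using that by (auto simp: p_def divide_right_mono)
      have walk: "sampled_drawdown X N \<omega> k = m - X (p k) \<omega>"
        using reflected_walk_increments[of "\<lambda>i. X (p i) \<omega>" k]
        by (simp add: m_def p_def sampled_increments_def[abs_def])
      have "m \<le> (SUP r\<in>{0..p k}. X r \<omega>)"
        unfolding m_def using p_mono
        by (intro Max.boundedI) (auto simp: p_def intro!: cSUP_upper bdd_above_path)
      moreover have "(SUP r\<in>{0..p k}. X r \<omega>) \<le> m + \<epsilon> / 4"
      proof (rule cSUP_least)
        fix u assume u: "u \<in> {0..p k}"
        define i where "i = sample_index N u"
        have i: "p i \<le> u" "u < p (Suc i)" "0 \<le> p i"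
          using sample_index_bounds[of u N] u by (auto simp: i_def p_def)
        have "i \<le> k"
          using sample_index_mono[of u "p k" N] u by (simp add: i_def p_def)
        moreover have "\<bar>X u \<omega> - X (p i) \<omega>\<bar> < \<epsilon> / 4"
          using u i k t elim p_Suc[of i] by (intro d(2)) auto
        ultimately show "X u \<omega> \<le> m + \<epsilon> / 4"
          using m[of i] by linarith
      qed (use k in auto)
      ultimately have "\<bar>drawdown X (p k) \<omega> - sampled_drawdown X N \<omega> k\<bar> \<le> \<epsilon> / 4"
        unfolding walk drawdown_def by linarith
      with 1 assms show "\<bar>drawdown X t \<omega> - sampled_drawdown X N \<omega> (sample_index N t)\<bar> < \<epsilon>"
        unfolding k_def by linarith
    qed
  qed
qed

lemma sampled_increments_small:
  assumes "0 < \<epsilon>"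
  shows "\<forall>\<^sub>F N in sequentially. \<forall>k<T * Suc N. \<bar>sampled_increments X N \<omega> k\<bar> < \<epsilon>"
proof -
  obtain d where d: "0 < d"
    "\<And>u v. u \<in> {0..real T} \<Longrightarrow> v \<in> {0..real T} \<Longrightarrow> \<bar>u - v\<bar> < d \<Longrightarrow> \<bar>X u \<omega> - X v \<omega>\<bar> < \<epsilon>"
    using path_uniformly_continuous[OF assms, of "real T"] by auto
  have "\<forall>\<^sub>F N in sequentially. 1 / real (Suc N) < d"
    using d(1) by real_asymp
  then show ?thesis
  proof eventually_elim
    case (elim N)
    show ?case
    proof (intro allI impI)
      fix k assume k: "k < T * Suc N"
      have "real (Suc k) \<le> real (T * Suc N)"
        using k by (intro of_nat_mono) simp
      then have "real (Suc k) / real (Suc N) \<le> real T"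
        by (subst divide_le_eq) (simp_all only: of_nat_mult, simp)
      moreover have "real (Suc k) / real (Suc N) = real k / real (Suc N) + 1 / real (Suc N)"
        by (simp add: add_divide_distrib)
      moreover have "0 \<le> real k / real (Suc N)" "0 < 1 / real (Suc N)"
        by simp_all
      ultimately show "\<bar>sampled_increments X N \<omega> k\<bar> < \<epsilon>"
        unfolding sampled_increments_def using elim
        by (intro d(2)) (unfold atLeastAtMost_iff, (intro conjI; linarith), (intro conjI; linarith), linarith)
    qed
  qed
qed

text \<open>For the converse, an infimum equal to \<open>t\<close> has to be excluded: by continuity
  the drawdown stays below \<open>c\<close> a little beyond \<open>t\<close>.\<close>

lemma less_drawdown_time_iff:
  assumes "0 \<le> t"
  shows "ennreal t < drawdown_time X c \<omega> \<longleftrightarrow> (\<forall>s\<in>{0..t}. drawdown X s \<omega> < c)"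
proof
  assume *: "ennreal t < drawdown_time X c \<omega>"
  show "\<forall>s\<in>{0..t}. drawdown X s \<omega> < c"
  proof (intro ballI, rule ccontr)
    fix s assume s: "s \<in> {0..t}" and "\<not> drawdown X s \<omega> < c"
    then have "drawdown_time X c \<omega> \<le> ennreal s"
      unfolding drawdown_time_def by (intro INF_lower) auto
    also have "\<dots> \<le> ennreal t"
      using s by (intro ennreal_leI) auto
    finally show False using * by simp
  qed
next
  assume *: "\<forall>s\<in>{0..t}. drawdown X s \<omega> < c"
  then have "0 < c - drawdown X t \<omega>"
    using assms by simp
  then obtain d where d: "0 < d"
    "\<And>r s. r \<in> {0..t + 1} \<Longrightarrow> s \<in> {0..t + 1} \<Longrightarrow> \<bar>r - s\<bar> < d
       \<Longrightarrow> \<bar>drawdown X r \<omega> - drawdown X s \<omega>\<bar> < c - drawdown X t \<omega>"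
    using drawdown_uniformly_continuous[of "c - drawdown X t \<omega>" "t + 1"] by blast
  \<comment> \<open>\<open>min 1\<close> keeps times before \<open>t'\<close> inside
    \<open>{0..t + 1}\<close>, where \<open>d\<close> applies; halving \<open>d\<close> keeps those
    after \<open>t\<close> within distance \<open>d\<close>.\<close>
  define t' where "t' = t + min 1 (d / 2)"
  have "t < t'" using d(1) by (simp add: t'_def)
  have "t' \<le> s" if s: "0 \<le> s" "c \<le> drawdown X s \<omega>" for s
  proof (rule ccontr)
    assume "\<not> t' \<le> s"
    then have s': "s < t + 1" "s < t + d"
      using d(1) by (auto simp: t'_def min_def split: if_splits)
    have "t < s" using * s by force
    then have "\<bar>drawdown X s \<omega> - drawdown X t \<omega>\<bar> < c - drawdown X t \<omega>"
      using s s' assms by (intro d(2)) auto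
    with s show False by simp
  qed
  then have "ennreal t' \<le> drawdown_time X c \<omega>"
    unfolding drawdown_time_def by (intro INF_greatest) (auto intro: ennreal_leI)
  moreover have "ennreal t < ennreal t'"
    using \<open>t < t'\<close> assms by (simp add: ennreal_lessI)
  ultimately show "ennreal t < drawdown_time X c \<omega>" by simp
qed

text \<open>The maximum over a compact interval is attained; half of the gap left below
  \<open>c\<close> serves as \<open>e\<close>.\<close>

lemma drawdown_less_uniformly:
  assumes "\<forall>s\<in>{0..t}. drawdown X s \<omega> < c" "0 \<le> t"
  obtains e where "0 < e" "\<And>s. s \<in> {0..t} \<Longrightarrow> drawdown X s \<omega> < c - e"
proof -
  have "continuous_on {0..t} (\<lambda>s. drawdown X s \<omega>)"
    by (rule continuous_on_subset[OF continuous_on_drawdown]) auto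
  then obtain r where r: "r \<in> {0..t}" "\<forall>s\<in>{0..t}. drawdown X s \<omega> \<le> drawdown X r \<omega>"
    using continuous_attains_sup[of "{0..t}" "\<lambda>s. drawdown X s \<omega>"] assms by auto
  then show ?thesis
    using assms by (intro that[of "(c - drawdown X r \<omega>) / 2"]) (force simp: field_simps)+
qed

lemma occupied_times_measurable: "occupied_times X a y \<omega> \<in> sets borel"
proof -
  \<comment> \<open>Continuity is known only on nonnegative times; the indicator extends the
    drawdown to a Borel function on the whole line.\<close>
  have [measurable]: "(\<lambda>s. indicator {0..} s *\<^sub>R drawdown X s \<omega>) \<in> borel_measurable borel"
    by (intro borel_measurable_continuous_on_indicator continuous_on_drawdown) auto
  have "occupied_times X a y \<omega>
      = {s. 0 \<le> s \<and> ennreal s < drawdown_time X a \<omega> \<and> y < indicator {0..} s *\<^sub>R drawdown X s \<omega>}"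
    by (auto simp: occupied_times_def less_drawdown_time_iff)
  also have "\<dots> \<in> sets borel"
    by measurable
  finally show ?thesis .
qed

text \<open>The definition includes the drawdown time itself and \<open>occupied_times\<close> does
  not; this affects at most one point.\<close>

lemma drawdown_occupation_time_eq:
  "drawdown_occupation_time X a y \<omega> = emeasure lborel (occupied_times X a y \<omega>)"
proof -
  let ?\<tau> = "drawdown_time X a \<omega>"
  have "drawdown_occupation_time X a y \<omega> = (\<integral>\<^sup>+s. indicator (occupied_times X a y \<omega>) s \<partial>lborel)"
    unfolding drawdown_occupation_time_def
  proof (rule nn_integral_cong_AE)
    \<comment> \<open>For an infinite drawdown time \<open>enn2real\<close> gives 0, and dropping
      that point is harmless.\<close>
    have "AE s in lborel. s \<noteq> enn2real ?\<tau>"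
      by (rule AE_lborel_singleton)
    then show "AE s in lborel. indicator {t. y < drawdown X t \<omega>} s * indicator {t. 0 \<le> t \<and> ennreal t \<le> ?\<tau>} s
        = (indicator (occupied_times X a y \<omega>) s :: ennreal)"
    proof eventually_elim
      case (elim s)
      have "ennreal s \<le> ?\<tau> \<longleftrightarrow> ennreal s < ?\<tau>" if "0 \<le> s"
        using elim enn2real_ennreal[OF that] by (metis le_less)
      then show ?case
        by (auto simp: occupied_times_def less_drawdown_time_iff indicator_def)
    qed
  qed
  then show ?thesis
    using occupied_times_measurable by simp
qed

text \<open>Raising \<open>y\<close> and lowering \<open>a\<close> leave room for the sampling
  error, and cutting at \<open>j\<close> gives the bounded time interval that uniform approximation
  asks for. Every occupied time enters eventually, as \<open>drawdown_less_uniformly\<close>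
  provides a margin below \<open>a\<close>.\<close>

lemma
  fixes a y :: real
  defines "O' \<equiv> \<lambda>j. occupied_times X (a - 1 / real (Suc j)) (y + 1 / real (Suc j)) \<omega> \<inter> {0..<real j}"
  shows incseq_occupied_times: "incseq O'"
    and drawdown_occupation_time_SUP: "drawdown_occupation_time X a y \<omega> = (SUP j. emeasure lborel (O' j))"
proof -
  have meas: "O' j \<in> sets lborel" for j
    using occupied_times_measurable by (auto simp: O'_def)
  show "incseq O'"
  proof (rule incseq_SucI)
    fix j
    have "1 / real (Suc (Suc j)) \<le> 1 / real (Suc j)"
      by (simp add: field_simps)
    then show "O' j \<subseteq> O' (Suc j)"
      unfolding O'_def occupied_times_def by force
  qed
  moreover have "(\<Union>j. O' j) = occupied_times X a y \<omega>"
  proof (intro equalityI subsetI)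
    fix s assume "s \<in> (\<Union>j. O' j)"
    then obtain j where j: "s \<in> O' j" by blast
    have pos: "0 < 1 / real (Suc j)" by simp
    have "drawdown X u \<omega> < a" if "u \<in> {0..s}" for u
    proof -
      have "drawdown X u \<omega> < a - 1 / real (Suc j)"
        using j that unfolding O'_def occupied_times_def by blast
      with pos show ?thesis by linarith
    qed
    moreover have "y < drawdown X s \<omega>" "0 \<le> s"
    proof -
      have "y + 1 / real (Suc j) < drawdown X s \<omega>" "s \<in> {0..<real j}"
        using j unfolding O'_def occupied_times_def by blast+
      with pos show "y < drawdown X s \<omega>" "0 \<le> s" by (linarith, simp)
    qed
    ultimately show "s \<in> occupied_times X a y \<omega>"
      by (simp add: occupied_times_def)
  next
    fix s assume s: "s \<in> occupied_times X a y \<omega>"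
    then obtain e where e: "0 < e" "\<And>u. u \<in> {0..s} \<Longrightarrow> drawdown X u \<omega> < a - e"
      using drawdown_less_uniformly[of s a] by (auto simp: occupied_times_def)
    have pos: "0 < drawdown X s \<omega> - y" using s by (simp add: occupied_times_def)
    have small: "\<forall>\<^sub>F j in sequentially. 1 / real (Suc j) < r" if "0 < r" for r :: real
      using that by real_asymp
    note small[OF e(1)]
    moreover note small[OF pos]
    moreover have "\<forall>\<^sub>F j in sequentially. s < real j"
      by real_asymp
    ultimately have "\<forall>\<^sub>F j in sequentially. s \<in> O' j"
    proof eventually_elim
      case (elim j)
      then show ?case
        using s e(2) unfolding O'_def occupied_times_def by force
    qed
    then obtain j where "s \<in> O' j"
      by (auto simp: eventually_sequentially)
    then show "s \<in> (\<Union>j. O' j)" by blast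
  qed
  ultimately show "drawdown_occupation_time X a y \<omega> = (SUP j. emeasure lborel (O' j))"
    using SUP_emeasure_incseq[of O' lborel] meas by (simp add: drawdown_occupation_time_eq image_subset_iff)
qed

text \<open>An approximation error below \<open>e\<close> is paid for by widening the band between
  \<open>y\<close> and \<open>a\<close> by \<open>e\<close> on both sides, in either direction of
  the comparison.\<close>

lemma
  fixes T N :: nat
  assumes approx: "\<And>t. t \<in> {0..real T} \<Longrightarrow> \<bar>drawdown X t \<omega> - sampled_drawdown X N \<omega> (sample_index N t)\<bar> < e"
  shows occupied_times_le_walk_occupation:
      "emeasure lborel (occupied_times X a y \<omega> \<inter> {0..<real T})
         \<le> ennreal (walk_occupation (a + e) (y - e) (T * Suc N) 0 (sampled_increments X N \<omega>) / real (Suc N))"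
    and walk_occupation_le_occupied_times:
      "ennreal (walk_occupation a y (T * Suc N) 0 (sampled_increments X N \<omega>) / real (Suc N))
         \<le> emeasure lborel (occupied_times X (a + e) (y - e) \<omega>)"
proof -
  let ?P = "\<lambda>a y k. y \<le> sampled_drawdown X N \<omega> k \<and> (\<forall>i\<le>k. sampled_drawdown X N \<omega> i < a)"
  have "occupied_times X a y \<omega> \<inter> {0..<real T} \<subseteq> {s\<in>{0..<real T}. ?P (a + e) (y - e) (sample_index N s)}"
  proof (safe, goal_cases)
    case (1 s)
    then show ?case using approx[of s] by (auto simp: occupied_times_def)
  next
    case (2 s i)
    have i: "real i / real (Suc N) \<in> {0..s}"
      using 2 sample_time_le by simp
    then have "drawdown X (real i / real (Suc N)) \<omega> < a"
      using 2 unfolding occupied_times_def by blast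
    moreover have "real i / real (Suc N) \<in> {0..real T}"
      using i 2 by simp
    ultimately show ?case
      using approx[of "real i / real (Suc N)"] unfolding sample_index_sample by linarith
  qed
  then show "emeasure lborel (occupied_times X a y \<omega> \<inter> {0..<real T})
         \<le> ennreal (walk_occupation (a + e) (y - e) (T * Suc N) 0 (sampled_increments X N \<omega>) / real (Suc N))"
    unfolding walk_occupation_def emeasure_sampled_times(2)[symmetric]
    by (rule emeasure_mono) (simp add: emeasure_sampled_times(1)[simplified])
  have "{s\<in>{0..<real T}. ?P a y (sample_index N s)} \<subseteq> occupied_times X (a + e) (y - e) \<omega>"
  proof (rule subsetI)
    fix s assume s: "s \<in> {s\<in>{0..<real T}. ?P a y (sample_index N s)}"
    have "drawdown X u \<omega> < a + e" if "u \<in> {0..s}" for u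
    proof -
      have "sampled_drawdown X N \<omega> (sample_index N u) < a"
        using s sample_index_mono[of u s N] that by auto
      then show ?thesis using approx[of u] s that by auto
    qed
    moreover have "y - e < drawdown X s \<omega>"
      using s approx[of s] by auto
    ultimately show "s \<in> occupied_times X (a + e) (y - e) \<omega>"
      using s by (auto simp: occupied_times_def)
  qed
  then show "ennreal (walk_occupation a y (T * Suc N) 0 (sampled_increments X N \<omega>) / real (Suc N))
         \<le> emeasure lborel (occupied_times X (a + e) (y - e) \<omega>)"
    unfolding walk_occupation_def emeasure_sampled_times(2)[symmetric]
    by (rule emeasure_mono) (simp add: occupied_times_measurable)
qed

end

section \<open>Processes with independent increments\<close>

text \<open>Fatou's lemma for the indicators of \<open>A N\<close>, and its reverse form for those
  of \<open>B N\<close>, dominated by the constant 1, which a finite measure integrates. Each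
  sequence of events is controlled in one direction only.\<close>

lemma (in finite_measure) emeasure_mono_eventually:
  assumes [measurable]: "\<And>N. A N \<in> sets M" "\<And>N. B N \<in> sets M" "E \<in> sets M" "F \<in> sets M"
    and le: "\<And>N. emeasure M (A N) \<le> emeasure M (B N)"
    and E: "\<And>\<omega>. \<omega> \<in> E \<Longrightarrow> \<forall>\<^sub>F N in sequentially. \<omega> \<in> A N"
    and F: "\<And>\<omega>. \<omega> \<in> space M \<Longrightarrow> \<omega> \<notin> F \<Longrightarrow> \<forall>\<^sub>F N in sequentially. \<omega> \<notin> B N"
  shows "emeasure M E \<le> emeasure M F"
proof -
  have "emeasure M E = (\<integral>\<^sup>+\<omega>. indicator E \<omega> \<partial>M)"
    by simp
  also have "\<dots> \<le> (\<integral>\<^sup>+\<omega>. liminf (\<lambda>N. indicator (A N) \<omega>) \<partial>M)"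
  proof (rule nn_integral_mono)
    fix \<omega>
    show "(indicator E \<omega> :: ennreal) \<le> liminf (\<lambda>N. indicator (A N) \<omega>)"
    proof (cases "\<omega> \<in> E")
      case True
      show ?thesis
        using E[OF True] by (intro Liminf_bounded) (auto elim: eventually_mono)
    qed simp
  qed
  also have "\<dots> \<le> liminf (\<lambda>N. \<integral>\<^sup>+\<omega>. indicator (A N) \<omega> \<partial>M)"
    by (rule nn_integral_liminf) simp
  also have "\<dots> \<le> liminf (\<lambda>N. \<integral>\<^sup>+\<omega>. indicator (B N) \<omega> \<partial>M)"
    by (intro Liminf_mono always_eventually allI) (simp add: le)
  also have "\<dots> \<le> limsup (\<lambda>N. \<integral>\<^sup>+\<omega>. indicator (B N) \<omega> \<partial>M)"
    by (rule Liminf_le_Limsup) simp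
  also have "\<dots> \<le> (\<integral>\<^sup>+\<omega>. limsup (\<lambda>N. indicator (B N) \<omega>) \<partial>M)"
    by (rule nn_integral_limsup[where w = "\<lambda>_. 1"])
       (auto simp: indicator_def less_top[symmetric] emeasure_finite)
  also have "\<dots> \<le> (\<integral>\<^sup>+\<omega>. indicator F \<omega> \<partial>M)"
  proof (rule nn_integral_mono)
    fix \<omega> assume \<omega>: "\<omega> \<in> space M"
    show "limsup (\<lambda>N. indicator (B N) \<omega>) \<le> (indicator F \<omega> :: ennreal)"
    proof (cases "\<omega> \<in> F")
      case True
      then show ?thesis
        by (intro Limsup_bounded always_eventually) (auto simp: indicator_def)
    next
      case False
      show ?thesis
        by (intro Limsup_bounded eventually_mono[OF F[OF \<omega> False]]) simp
    qed
  qed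
  also have "\<dots> = emeasure M F"
    by simp
  finally show ?thesis .
qed

text \<open>Open upper rays form a pi-system generating the Borel sets. They all miss 0, so
  \<open>UNIV\<close> is added to cover the space; its mass is 1 on both sides.\<close>

lemma borel_ennreal_measure_eqI:
  fixes M N :: "ennreal measure"
  assumes "prob_space M" "prob_space N" and [simp]: "sets M = sets borel" "sets N = sets borel"
    and eq: "\<And>t. emeasure M {t<..} = emeasure N {t<..}"
  shows "M = N"
proof (rule measure_eqI_generator_eq[where E = "insert UNIV (range greaterThan)" and \<Omega> = UNIV and A = "\<lambda>_. UNIV"])
  interpret M: prob_space M by fact
  interpret N: prob_space N by fact
  have sp: "space M = UNIV" "space N = UNIV"
    using sets_eq_imp_space_eq[of M borel] sets_eq_imp_space_eq[of N borel] by simp_all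
  have 1: "emeasure M UNIV = 1" "emeasure N UNIV = 1"
    using M.emeasure_space_1 N.emeasure_space_1 by (simp_all add: sp)
  show "emeasure M X = emeasure N X" if "X \<in> insert UNIV (range greaterThan)" for X
    using that by (auto simp: 1 eq)
  show "emeasure M UNIV \<noteq> \<infinity>" for i :: nat
    by (simp add: 1)
  have "{s<..} \<inter> {t<..} = {max s t<..}" for s t :: ennreal
    by auto
  then show "Int_stable (insert UNIV (range greaterThan :: ennreal set set))"
    by (auto simp: Int_stable_def)
  have "sigma_sets UNIV (insert UNIV (range greaterThan)) = sigma_sets UNIV (range greaterThan :: ennreal set set)"
    by (intro sigma_sets_eqI) (auto intro: sigma_sets_top)
  then have "sets borel = sigma_sets UNIV (insert UNIV (range greaterThan :: ennreal set set))"
    by (simp add: borel_Ioi)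
  then show "sets M = sigma_sets UNIV (insert UNIV (range greaterThan))"
    "sets N = sigma_sets UNIV (insert UNIV (range greaterThan))"
    by simp_all
qed auto

text \<open>By independence this is the \<open>n\<close>-th power of the one-step
  probability.\<close>

lemma (in real_sequence_space) emeasure_all_greater_tendsto_0:
  assumes "emeasure Q {x \<in> space Q. b < x} < 1"
  shows "(\<lambda>n. emeasure S {s \<in> space S. \<forall>i<n. b < s i}) \<longlonglongrightarrow> 0"
proof -
  let ?p = "emeasure Q {x \<in> space Q. b < x}"
  have "emeasure S {s \<in> space S. \<forall>i<n. b < s i} = ?p ^ n" for n
  proof (induction n)
    case 0
    then show ?case by (simp add: P.emeasure_space_1)
  next
    case (Suc n)
    have "emeasure S {s \<in> space S. \<forall>i<Suc n. b < s i}
        = (\<integral>\<^sup>+x. emeasure S {s \<in> space S. \<forall>i<Suc n. b < case_nat x s i} \<partial>Q)"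
      by (rule emeasure_S_first_step) measurable
    also have "\<dots> = (\<integral>\<^sup>+x. ?p ^ n * indicator {x \<in> space Q. b < x} x \<partial>Q)"
      by (intro nn_integral_cong) (auto simp: All_less_Suc2 indicator_def Suc.IH)
    also have "\<dots> = ?p ^ n * ?p"
      by (rule nn_integral_cmult_indicator) measurable
    finally show ?case by (simp add: mult.commute)
  qed
  moreover have "(\<lambda>n. ?p ^ n) \<longlonglongrightarrow> 0"
  proof -
    obtain r where r: "?p = ennreal r" "0 \<le> r" "r < 1"
      using assms by (cases ?p) (auto simp: ennreal_less_one_iff top_unique)
    have "(\<lambda>n. ennreal (r ^ n)) \<longlonglongrightarrow> ennreal 0"
      using r by (intro tendsto_ennrealI LIMSEQ_power_zero) auto
    then show ?thesis using r by (simp add: ennreal_power)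
  qed
  ultimately show ?thesis by simp
qed

text \<open>\<open>iid\<close> is imposed at every mesh, with a law \<open>Q\<close> that may depend
  on it. \<open>drop\<close> says that a fall of any size over the first unit of time has positive
  probability; it makes drawdown times almost surely finite.\<close>

locale continuous_iid_increments = prob_space M for M :: "'a measure" +
  fixes X :: "real \<Rightarrow> 'a \<Rightarrow> real"
  assumes paths: "\<And>\<omega>. \<omega> \<in> space M \<Longrightarrow> continuous_path X \<omega>"
    and X_measurable: "\<And>t. 0 \<le> t \<Longrightarrow> X t \<in> borel_measurable M"
    and iid: "\<And>N. \<exists>Q. real_sequence_space Q \<and>
      distr M (\<Pi>\<^sub>M i\<in>UNIV. borel) (sampled_increments X N) = (\<Pi>\<^sub>M i\<in>UNIV. Q)"
    and drop: "\<And>b. emeasure M {\<omega> \<in> space M. b < sampled_increments X 0 \<omega> 0} < 1"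
begin

section \<open>Measurability of the drawdown functionals\<close>

lemma sampled_increments_measurable [measurable]:
  "(\<lambda>\<omega>. sampled_increments X N \<omega> i) \<in> borel_measurable M"
  unfolding sampled_increments_def by (intro borel_measurable_diff X_measurable) auto

lemma sampled_increments_measurable_PiM [measurable]:
  "sampled_increments X N \<in> M \<rightarrow>\<^sub>M (\<Pi>\<^sub>M i\<in>UNIV. borel)"
  using measurable_PiM_single'[of UNIV "\<lambda>i \<omega>. sampled_increments X N \<omega> i" M "\<lambda>_. borel"]
  by (simp add: sampled_increments_measurable)

lemma sampled_drawdown_measurable [measurable]:
  "(\<lambda>\<omega>. sampled_drawdown X N \<omega> k) \<in> borel_measurable M"
  by (rule borel_measurable_reflected_walk) measurable

text \<open>The drawdown is the pointwise limit of its sampled versions, each jointly measurable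
  because the sample index takes countably many values.\<close>

lemma drawdown_measurable_pair [measurable]:
  "(\<lambda>(\<omega>, t). indicator {0..} t *\<^sub>R drawdown X t \<omega>) \<in> borel_measurable (M \<Otimes>\<^sub>M borel)"
proof -
  have [measurable]: "(\<lambda>p. sampled_drawdown X N (fst p) (sample_index N (snd p))) \<in> borel_measurable (M \<Otimes>\<^sub>M borel)" for N
    by (rule measurable_compose_countable[where f = "\<lambda>k p. sampled_drawdown X N (fst p) k"
          and g = "\<lambda>p. sample_index N (snd p)"]) measurable
  have "(\<lambda>p. indicator {0..} (snd p) *\<^sub>R drawdown X (snd p) (fst p)) \<in> borel_measurable (M \<Otimes>\<^sub>M (borel :: real measure))"
  proof (rule borel_measurable_LIMSEQ_real)
    fix p :: "'a \<times> real" assume p: "p \<in> space (M \<Otimes>\<^sub>M borel)"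
    obtain \<omega> t where p_eq: "p = (\<omega>, t)" by (cases p)
    interpret continuous_path X \<omega>
      using p paths by (auto simp: p_eq space_pair_measure)
    show "(\<lambda>N. indicator {0..} (snd p) *\<^sub>R sampled_drawdown X N (fst p) (sample_index N (snd p)))
        \<longlonglongrightarrow> indicator {0..} (snd p) *\<^sub>R drawdown X (snd p) (fst p)"
    proof (cases "0 \<le> t")
      case True
      have "(\<lambda>N. sampled_drawdown X N \<omega> (sample_index N t)) \<longlonglongrightarrow> drawdown X t \<omega>"
      proof (rule tendstoI)
        fix e :: real assume "0 < e"
        from sampled_drawdown_approx[OF this True]
        show "\<forall>\<^sub>F N in sequentially. dist (sampled_drawdown X N \<omega> (sample_index N t)) (drawdown X t \<omega>) < e"
          by eventually_elim (use True in \<open>auto simp: dist_real_def abs_minus_commute\<close>)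
      qed
      then show ?thesis by (simp add: p_eq tendsto_mult)
    qed (simp add: p_eq)
  qed measurable
  then show ?thesis by (simp add: case_prod_beta')
qed

text \<open>Replaces an uncountable condition on the path by countably many conditions on samples,
  for the measurability of \<open>drawdown_time\<close>. The margin \<open>1 / real (Suc j)\<close>
  lets the strict inequality survive the approximation.\<close>

lemma all_drawdown_less_iff:
  assumes "\<omega> \<in> space M" "0 \<le> t"
  shows "(\<forall>s\<in>{0..t}. drawdown X s \<omega> < c) \<longleftrightarrow>
    (\<exists>j. \<forall>\<^sub>F N in sequentially. \<forall>k\<le>sample_index N t. sampled_drawdown X N \<omega> k < c - 1 / real (Suc j))"
    (is "?L \<longleftrightarrow> ?R")
proof -
  interpret continuous_path X \<omega> using assms paths by simp
  show ?thesis
  proof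
    assume ?L
    then obtain e where e: "0 < e" "\<And>s. s \<in> {0..t} \<Longrightarrow> drawdown X s \<omega> < c - e"
      using drawdown_less_uniformly assms by blast
    obtain j where j: "1 / real (Suc j) < e / 2"
      using nat_approx_posE[of "e / 2"] e(1) by auto
    have "\<forall>\<^sub>F N in sequentially. \<forall>s\<in>{0..t}. \<bar>drawdown X s \<omega> - sampled_drawdown X N \<omega> (sample_index N s)\<bar> < e / 2"
      using e(1) assms by (intro sampled_drawdown_approx) auto
    then have "\<forall>\<^sub>F N in sequentially. \<forall>k\<le>sample_index N t. sampled_drawdown X N \<omega> k < c - 1 / real (Suc j)"
    proof eventually_elim
      case (elim N)
      show ?case
      proof (intro allI impI)
        fix k assume k: "k \<le> sample_index N t"
        have s: "real k / real (Suc N) \<in> {0..t}"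
          using sample_time_le[OF k assms(2)] by simp
        show "sampled_drawdown X N \<omega> k < c - 1 / real (Suc j)"
          using bspec[OF elim s] e(2)[OF s] j unfolding sample_index_sample by linarith
      qed
    qed
    then show ?R ..
  next
    assume ?R
    then obtain j where j: "\<forall>\<^sub>F N in sequentially. \<forall>k\<le>sample_index N t. sampled_drawdown X N \<omega> k < c - 1 / real (Suc j)" ..
    have pos: "0 < 1 / real (Suc j)" by simp
    from j sampled_drawdown_approx[OF pos assms(2)]
    have "\<forall>\<^sub>F N in sequentially. ?L"
    proof eventually_elim
      case (elim N)
      show ?case
      proof
        fix s assume s: "s \<in> {0..t}"
        then have "sample_index N s \<le> sample_index N t"
          by (intro sample_index_mono) auto
        with elim(1) have "sampled_drawdown X N \<omega> (sample_index N s) < c - 1 / real (Suc j)"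
          by blast
        with bspec[OF elim(2) s] show "drawdown X s \<omega> < c" by linarith
      qed
    qed
    then show ?L unfolding eventually_const_iff by simp
  qed
qed

lemma less_drawdown_time_iff:
  assumes "\<omega> \<in> space M" "0 \<le> t"
  shows "ennreal t < drawdown_time X c \<omega> \<longleftrightarrow> (\<forall>s\<in>{0..t}. drawdown X s \<omega> < c)"
  by (rule continuous_path.less_drawdown_time_iff[OF paths[OF assms(1)] assms(2)])

lemma drawdown_time_measurable [measurable]: "drawdown_time X c \<in> borel_measurable M"
proof (rule borel_measurableI_greater)
  fix y :: ennreal
  show "{\<omega> \<in> space M. y < drawdown_time X c \<omega>} \<in> sets M"
  proof (cases y)
    case (real t)
    have "{\<omega> \<in> space M. y < drawdown_time X c \<omega>} = {\<omega> \<in> space M. \<exists>j. \<forall>\<^sub>F N in sequentially.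
        \<forall>k\<le>sample_index N t. sampled_drawdown X N \<omega> k < c - 1 / real (Suc j)}"
      unfolding real(2)
      by (rule Collect_cong, rule conj_cong[OF refl])
         (rule trans[OF less_drawdown_time_iff all_drawdown_less_iff, OF _ real(1) _ real(1)])
    also have "\<dots> \<in> sets M"
      unfolding eventually_sequentially by measurable
    finally show ?thesis .
  qed simp
qed

lemma occupied_times_measurable_pair [measurable]:
  assumes [measurable]: "A \<in> sets borel"
  shows "(\<lambda>\<omega>. emeasure lborel (occupied_times X a y \<omega> \<inter> A)) \<in> borel_measurable M"
proof -
  \<comment> \<open>Written through \<open>drawdown_time\<close>, membership becomes a jointly
    measurable predicate whose integral over \<open>s\<close> is measurable in the path.\<close>
  let ?P = "\<lambda>\<omega> s. 0 \<le> s \<and> ennreal s < drawdown_time X a \<omega> \<and> y < indicator {0..} s *\<^sub>R drawdown X s \<omega> \<and> s \<in> A"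
  have "(\<lambda>\<omega>. \<integral>\<^sup>+s. of_bool (?P \<omega> s) \<partial>lborel) \<in> borel_measurable M"
    by measurable
  also have "?this \<longleftrightarrow> ?thesis"
  proof (rule measurable_cong)
    fix \<omega> assume \<omega>: "\<omega> \<in> space M"
    have "occupied_times X a y \<omega> \<in> sets borel"
      by (rule continuous_path.occupied_times_measurable[OF paths[OF \<omega>]])
    then have "emeasure lborel (occupied_times X a y \<omega> \<inter> A) = (\<integral>\<^sup>+s. indicator (occupied_times X a y \<omega> \<inter> A) s \<partial>lborel)"
      by simp
    also have "\<dots> = (\<integral>\<^sup>+s. of_bool (?P \<omega> s) \<partial>lborel)"
      by (rule nn_integral_cong)
         (auto simp: occupied_times_def less_drawdown_time_iff[OF \<omega>] indicator_def)
    finally show "(\<integral>\<^sup>+s. of_bool (?P \<omega> s) \<partial>lborel) = emeasure lborel (occupied_times X a y \<omega> \<inter> A)" ..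
  qed
  finally show ?thesis .
qed

lemma drawdown_occupation_time_eq:
  "\<omega> \<in> space M \<Longrightarrow> drawdown_occupation_time X a y \<omega> = emeasure lborel (occupied_times X a y \<omega>)"
  by (rule continuous_path.drawdown_occupation_time_eq[OF paths])

lemma drawdown_occupation_time_measurable [measurable]:
  "drawdown_occupation_time X a y \<in> borel_measurable M"
  using occupied_times_measurable_pair[of UNIV a y]
  by (subst measurable_cong[OF drawdown_occupation_time_eq]) auto

lemma emeasure_sampled_increments:
  assumes [measurable]: "Measurable.pred (\<Pi>\<^sub>M i\<in>UNIV. borel) P"
    and Q: "distr M (\<Pi>\<^sub>M i\<in>UNIV. borel) (sampled_increments X N) = (\<Pi>\<^sub>M i\<in>UNIV. Q)"
  shows "emeasure M {\<omega> \<in> space M. P (sampled_increments X N \<omega>)}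
    = emeasure (\<Pi>\<^sub>M i\<in>UNIV. Q) {s \<in> space (\<Pi>\<^sub>M i\<in>UNIV. Q). P s}"
proof -
  have sp: "space (\<Pi>\<^sub>M i\<in>UNIV. Q) = space (\<Pi>\<^sub>M i\<in>UNIV::nat set. borel)"
    using arg_cong[OF Q, of space] by simp
  have set: "{s \<in> space (\<Pi>\<^sub>M i\<in>UNIV::nat set. borel). P s} \<in> sets (\<Pi>\<^sub>M i\<in>UNIV. borel)"
    by measurable
  show ?thesis
    unfolding sp unfolding Q[symmetric] emeasure_distr[OF sampled_increments_measurable_PiM set]
    by (rule arg_cong[where f = "emeasure M"]) (auto simp: space_PiM)
qed

text \<open>At mesh 1, a single step of at most \<open>- a\<close> forces the drawdown up to
  \<open>a\<close>, and independent attempts all fail with probability zero.\<close>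

lemma AE_drawdown_time_finite: "AE \<omega> in M. drawdown_time X a \<omega> < \<infinity>"
proof -
  obtain Q where Q: "real_sequence_space Q"
      "distr M (\<Pi>\<^sub>M i\<in>UNIV. borel) (sampled_increments X 0) = (\<Pi>\<^sub>M i\<in>UNIV. Q)"
    using iid by blast
  interpret Q: real_sequence_space Q by fact
  let ?E = "\<lambda>n. {\<omega> \<in> space M. \<forall>i<n. - a < sampled_increments X 0 \<omega> i}"
  have E: "emeasure M (?E n) = emeasure Q.S {s \<in> space Q.S. \<forall>i<n. - a < s i}" for n
    by (rule emeasure_sampled_increments[OF _ Q(2)]) measurable
  \<comment> \<open>Reading off the first coordinate identifies the one-step probability under
    \<open>Q\<close> with the quantity in \<open>drop\<close>.\<close>
  have "emeasure Q.S {s \<in> space Q.S. \<forall>i<1. - a < s i}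
      = (\<integral>\<^sup>+x. emeasure Q.S {s \<in> space Q.S. \<forall>i<1::nat. - a < case_nat x s i} \<partial>Q)"
    by (rule Q.emeasure_S_first_step) measurable
  also have "\<dots> = (\<integral>\<^sup>+x. indicator {x \<in> space Q. - a < x} x \<partial>Q)"
    by (intro nn_integral_cong) (simp add: Q.P.emeasure_space_1 indicator_def)
  also have "\<dots> = emeasure Q {x \<in> space Q. - a < x}"
    by (rule nn_integral_indicator) measurable
  finally have "emeasure Q {x \<in> space Q. - a < x} = emeasure Q.S {s \<in> space Q.S. \<forall>i<1. - a < s i}" ..
  also have "\<dots> = emeasure M {\<omega> \<in> space M. - a < sampled_increments X 0 \<omega> 0}"
    using E[of 1] by simp
  finally have "emeasure Q {x \<in> space Q. - a < x} < 1"
    using drop by simp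
  then have lim: "(\<lambda>n. emeasure M (?E n)) \<longlonglongrightarrow> 0"
    unfolding E by (rule Q.emeasure_all_greater_tendsto_0)
  have "{\<omega> \<in> space M. \<not> drawdown_time X a \<omega> < \<infinity>} \<subseteq> ?E n" for n
  proof (safe, rule ccontr)
    fix \<omega> i assume \<omega>: "\<omega> \<in> space M" and fin: "\<not> drawdown_time X a \<omega> < \<infinity>"
      and "\<not> - a < sampled_increments X 0 \<omega> i"
    interpret continuous_path X \<omega> using \<omega> paths by simp
    have "X (real i) \<omega> \<le> (SUP s\<in>{0..real (Suc i)}. X s \<omega>)"
      by (intro cSUP_upper bdd_above_path) auto
    then have "a \<le> drawdown X (real (Suc i)) \<omega>"
      using \<open>\<not> - a < sampled_increments X 0 \<omega> i\<close>
      by (simp add: drawdown_def sampled_increments_def)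
    then have "drawdown_time X a \<omega> \<le> ennreal (real (Suc i))"
      unfolding drawdown_time_def by (intro INF_lower) auto
    also have "\<dots> < \<infinity>" by simp
    finally show False using fin by simp
  qed
  then have "emeasure M {\<omega> \<in> space M. \<not> drawdown_time X a \<omega> < \<infinity>} \<le> emeasure M (?E n)" for n
    by (intro emeasure_mono) measurable
  then have "emeasure M {\<omega> \<in> space M. \<not> drawdown_time X a \<omega> < \<infinity>} \<le> 0"
    by (intro LIMSEQ_le_const[OF lim]) auto
  then show ?thesis
    by (subst AE_iff_measurable[OF _ refl]) auto
qed

section \<open>Comparison of the tails and passage to the limit\<close>

lemma walk_occupation_sampled_measurable [measurable]:
  "(\<lambda>\<omega>. walk_occupation a y n z (sampled_increments X N \<omega>)) \<in> borel_measurable M"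
  by (rule borel_measurable_walk_occupation) measurable

text \<open>The term \<open>3 * e\<close> collects \<open>e\<close> for each of the two levels when
  the occupation passes to the walk, and \<open>e\<close> for the return from the walk to the
  drawdown.\<close>

lemma emeasure_occupation_le:
  assumes e: "0 < e" "e \<le> y" and t: "0 \<le> t"
  shows "emeasure M {\<omega> \<in> space M. ennreal t < emeasure lborel (occupied_times X a y \<omega> \<inter> {0..<real T})}
    \<le> emeasure M {\<omega> \<in> space M. ennreal t < drawdown_time X (a - y + 3 * e) \<omega>}"
proof (rule emeasure_mono_eventually)
  let ?A = "\<lambda>N. {\<omega> \<in> space M. real (sample_index N t)
                   < walk_occupation (a + e) (y - e) (T * Suc N) 0 (sampled_increments X N \<omega>)}"
  let ?B = "\<lambda>N. {\<omega> \<in> space M. \<forall>k\<le>sample_index N t. sampled_drawdown X N \<omega> k < a + e - (y - e)}"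
  show "?A N \<in> events" "?B N \<in> events" for N
    by measurable
  show "emeasure M (?A N) \<le> emeasure M (?B N)" for N
  proof -
    obtain Q where Q: "real_sequence_space Q"
      "distr M (\<Pi>\<^sub>M i\<in>UNIV. borel) (sampled_increments X N) = (\<Pi>\<^sub>M i\<in>UNIV. Q)"
      using iid by blast
    interpret Q: real_sequence_space Q by fact
    let ?m = "sample_index N t"
    have "emeasure M (?A N) = emeasure Q.S {s \<in> space Q.S. real ?m < walk_occupation (a + e) (y - e) (T * Suc N) 0 s}"
    proof (rule emeasure_sampled_increments[OF _ Q(2)])
      have [measurable]: "(\<lambda>s. walk_occupation (a + e) (y - e) (T * Suc N) 0 s) \<in> borel_measurable (\<Pi>\<^sub>M i\<in>UNIV. borel)"
        by (rule borel_measurable_walk_occupation) measurable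
      show "Measurable.pred (\<Pi>\<^sub>M i\<in>UNIV. borel) (\<lambda>s. real ?m < walk_occupation (a + e) (y - e) (T * Suc N) 0 s)"
        by measurable
    qed
    also have "\<dots> \<le> Q.survival (a + e - (y - e)) ?m (max 0 (0 - (y - e)))"
      by (rule Q.emeasure_occupation_le_survival)
    \<comment> \<open>\<open>e <= y\<close> lets the comparison walk start at 0.\<close>
    also have "max 0 (0 - (y - e)) = 0"
      using e by simp
    also have "Q.survival (a + e - (y - e)) ?m 0 = emeasure M (?B N)"
      unfolding Q.survival_def
    proof (rule emeasure_sampled_increments[OF _ Q(2), symmetric])
      have [measurable]: "(\<lambda>s. reflected_walk 0 s k) \<in> borel_measurable (\<Pi>\<^sub>M i\<in>UNIV. borel)" for k
        by (rule borel_measurable_reflected_walk) measurable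
      show "Measurable.pred (\<Pi>\<^sub>M i\<in>UNIV. borel) (\<lambda>s. \<forall>k\<le>?m. reflected_walk 0 s k < a + e - (y - e))"
        by measurable
    qed
    finally show ?thesis .
  qed
  show "{\<omega> \<in> space M. ennreal t < emeasure lborel (occupied_times X a y \<omega> \<inter> {0..<real T})} \<in> events"
    "{\<omega> \<in> space M. ennreal t < drawdown_time X (a - y + 3 * e) \<omega>} \<in> events"
    by measurable
next
  fix \<omega> assume \<omega>: "\<omega> \<in> {\<omega> \<in> space M. ennreal t < emeasure lborel (occupied_times X a y \<omega> \<inter> {0..<real T})}"
  interpret continuous_path X \<omega> using \<omega> paths by simp
  have "\<forall>\<^sub>F N in sequentially. \<forall>t\<in>{0..real T}. \<bar>drawdown X t \<omega> - sampled_drawdown X N \<omega> (sample_index N t)\<bar> < e"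
    using e by (intro sampled_drawdown_approx) auto
  then show "\<forall>\<^sub>F N in sequentially. \<omega> \<in> {\<omega> \<in> space M. real (sample_index N t)
      < walk_occupation (a + e) (y - e) (T * Suc N) 0 (sampled_increments X N \<omega>)}"
  proof eventually_elim
    case (elim N)
    let ?w = "walk_occupation (a + e) (y - e) (T * Suc N) 0 (sampled_increments X N \<omega>)"
    have "ennreal t < emeasure lborel (occupied_times X a y \<omega> \<inter> {0..<real T})"
      using \<omega> by simp
    also have "\<dots> \<le> ennreal (?w / real (Suc N))"
      using elim by (intro occupied_times_le_walk_occupation) auto
    finally have "t < ?w / real (Suc N)"
      using t by (simp add: ennreal_less_iff)
    with sample_index_bounds(1)[OF t, of N] have "real (sample_index N t) / real (Suc N) < ?w / real (Suc N)"
      by linarith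
    then show ?case
      using \<omega> by (simp add: divide_less_cancel)
  qed
next
  fix \<omega> assume \<omega>: "\<omega> \<in> space M"
    and "\<omega> \<notin> {\<omega> \<in> space M. ennreal t < drawdown_time X (a - y + 3 * e) \<omega>}"
  then obtain s where s: "s \<in> {0..t}" "a - y + 3 * e \<le> drawdown X s \<omega>"
    using less_drawdown_time_iff[OF \<omega> t] by (auto simp: not_less)
  interpret continuous_path X \<omega> using \<omega> paths by simp
  from sampled_drawdown_approx[OF e(1) t]
  show "\<forall>\<^sub>F N in sequentially. \<omega> \<notin> {\<omega> \<in> space M. \<forall>k\<le>sample_index N t. sampled_drawdown X N \<omega> k < a + e - (y - e)}"
  proof eventually_elim
    case (elim N)
    have "sample_index N s \<le> sample_index N t"
      using s by (intro sample_index_mono) auto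
    moreover have "\<not> sampled_drawdown X N \<omega> (sample_index N s) < a + e - (y - e)"
      using bspec[OF elim s(1)] s(2) by linarith
    ultimately show ?case by blast
  qed
qed

text \<open>The term \<open>4 * e\<close> pays \<open>e\<close> for each of the two levels,
  \<open>e\<close> for the overshoot and \<open>e\<close> for sampling. Paths that have not reached
  \<open>a\<close> by time \<open>T\<close> stay as an extra event, removed later by letting
  \<open>T\<close> grow.\<close>

lemma le_emeasure_occupation:
  assumes e: "0 < e" "0 \<le> y" and t: "0 \<le> t"
  shows "emeasure M {\<omega> \<in> space M. ennreal t < drawdown_time X (a - y - 4 * e) \<omega>}
    \<le> emeasure M {\<omega> \<in> space M. ennreal t < drawdown_occupation_time X a y \<omega> \<or> ennreal (real T) < drawdown_time X a \<omega>}"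
proof (rule emeasure_mono_eventually)
  define A where "A = (\<lambda>N. {\<omega> \<in> space M. \<forall>k\<le>sample_index N t. sampled_drawdown X N \<omega> k < a - e - (y + e) - e})"
  define E where "E = (\<lambda>N s. real (sample_index N t) < walk_occupation (a - e) (y + e) (T * Suc N) 0 s
      \<or> (\<forall>k\<le>T * Suc N. reflected_walk 0 s k < a - e) \<or> (\<exists>k<T * Suc N. e < \<bar>s k\<bar>))"
  let ?B = "\<lambda>N. {\<omega> \<in> space M. E N (sampled_increments X N \<omega>)}"
  show "A N \<in> events" "?B N \<in> events" for N
    unfolding E_def A_def by measurable
  show "emeasure M (A N) \<le> emeasure M (?B N)" for N
  proof -
    obtain Q where Q: "real_sequence_space Q"
      "distr M (\<Pi>\<^sub>M i\<in>UNIV. borel) (sampled_increments X N) = (\<Pi>\<^sub>M i\<in>UNIV. Q)"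
      using iid by blast
    interpret Q: real_sequence_space Q by fact
    have walk [measurable]: "(\<lambda>s. reflected_walk 0 s k) \<in> borel_measurable (\<Pi>\<^sub>M i\<in>UNIV. borel)" for k
      by (rule borel_measurable_reflected_walk) measurable
    have [measurable]: "(\<lambda>s. walk_occupation (a - e) (y + e) n 0 s) \<in> borel_measurable (\<Pi>\<^sub>M i\<in>UNIV. borel)" for n
      by (rule borel_measurable_walk_occupation) measurable
    let ?m = "sample_index N t"
    have "emeasure M (A N) = Q.survival (a - e - (y + e) - e) ?m 0"
      unfolding Q.survival_def A_def by (rule emeasure_sampled_increments[OF _ Q(2)]) measurable
    also have "0 = max 0 (0 - (y + e) - e)"
      using e by simp
    also have "Q.survival (a - e - (y + e) - e) ?m (max 0 (0 - (y + e) - e))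
        \<le> emeasure Q.S {s \<in> space Q.S. E N s}"
      unfolding E_def using e by (intro Q.survival_le_emeasure_occupation) auto
    also have "\<dots> = emeasure M (?B N)"
      unfolding E_def by (rule emeasure_sampled_increments[OF _ Q(2), symmetric]) measurable
    finally show ?thesis .
  qed
  show "{\<omega> \<in> space M. ennreal t < drawdown_time X (a - y - 4 * e) \<omega>} \<in> events"
    "{\<omega> \<in> space M. ennreal t < drawdown_occupation_time X a y \<omega> \<or> ennreal (real T) < drawdown_time X a \<omega>} \<in> events"
    by measurable
  show "\<forall>\<^sub>F N in sequentially. \<omega> \<in> A N"
    if "\<omega> \<in> {\<omega> \<in> space M. ennreal t < drawdown_time X (a - y - 4 * e) \<omega>}" for \<omega>
  proof -
    have \<omega>: "\<omega> \<in> space M" and less: "\<And>s. s \<in> {0..t} \<Longrightarrow> drawdown X s \<omega> < a - y - 4 * e"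
      using that less_drawdown_time_iff t by auto
    interpret continuous_path X \<omega> using \<omega> paths by simp
    from sampled_drawdown_approx[OF e(1) t] show ?thesis
    proof eventually_elim
      case (elim N)
      have "sampled_drawdown X N \<omega> k < a - e - (y + e) - e" if k: "k \<le> sample_index N t" for k
      proof -
        have s: "real k / real (Suc N) \<in> {0..t}"
          using sample_time_le[OF k t] by simp
        show ?thesis
          using bspec[OF elim s] less[OF s] unfolding sample_index_sample by linarith
      qed
      then show ?case using \<omega> by (simp add: A_def)
    qed
  qed
  \<comment> \<open>For large \<open>N\<close> all three alternatives of \<open>E\<close> fail: the
    path reaches \<open>a\<close> by time \<open>T\<close>, the occupation time is at most
    \<open>t\<close>, and the sampled steps are below \<open>e\<close>.\<close>
  show "\<forall>\<^sub>F N in sequentially. \<omega> \<notin> ?B N" if \<omega>: "\<omega> \<in> space M"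
    and "\<omega> \<notin> {\<omega> \<in> space M. ennreal t < drawdown_occupation_time X a y \<omega> \<or> ennreal (real T) < drawdown_time X a \<omega>}" for \<omega>
  proof -
    interpret continuous_path X \<omega> using \<omega> paths by simp
    have C: "drawdown_occupation_time X a y \<omega> \<le> ennreal t"
      and "\<not> ennreal (real T) < drawdown_time X a \<omega>"
      using that by auto
    then have "\<not> (\<forall>s\<in>{0..real T}. drawdown X s \<omega> < a)"
      using less_drawdown_time_iff[of "real T" a] by simp
    then obtain s where s: "s \<in> {0..real T}" "a \<le> drawdown X s \<omega>"
      using not_less by blast
    have "\<forall>\<^sub>F N in sequentially. \<forall>t\<in>{0..real T}. \<bar>drawdown X t \<omega> - sampled_drawdown X N \<omega> (sample_index N t)\<bar> < e"
      using e by (intro sampled_drawdown_approx) auto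
    with sampled_increments_small[OF e(1), of T] show ?thesis
    proof eventually_elim
      case (elim N)
      let ?w = "walk_occupation (a - e) (y + e) (T * Suc N) 0 (sampled_increments X N \<omega>)"
      have "sample_index N s \<le> sample_index N (real T)"
        using s by (intro sample_index_mono) auto
      also have "\<dots> = T * Suc N"
        by (rule sample_index_eqI) (simp_all add: field_simps)
      finally have 1: "sample_index N s \<le> T * Suc N" .
      have "\<not> sampled_drawdown X N \<omega> (sample_index N s) < a - e"
        using bspec[OF elim(2) s(1)] s(2) by linarith
      moreover have "\<not> real (sample_index N t) < ?w"
      proof
        assume *: "real (sample_index N t) < ?w"
        \<comment> \<open>The floor alone would lose a fraction of a cell; integrality supplies a
          whole one, and \<open>t\<close> lies below the next grid point.\<close>
        obtain n where "?w = real n"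
          using walk_occupation_of_nat by blast
        with * have "real (Suc (sample_index N t)) \<le> ?w" by simp
        then have "real (Suc (sample_index N t)) / real (Suc N) \<le> ?w / real (Suc N)"
          by (rule divide_right_mono) simp
        then have "t < ?w / real (Suc N)"
          using sample_index_bounds(2)[OF t, of N] by linarith
        then have "ennreal t < ennreal (?w / real (Suc N))"
          using t by (simp add: ennreal_lessI)
        also have "\<dots> \<le> emeasure lborel (occupied_times X (a - e + e) (y + e - e) \<omega>)"
          using elim(2) by (intro walk_occupation_le_occupied_times) auto
        also have "\<dots> = drawdown_occupation_time X a y \<omega>"
          by (simp add: drawdown_occupation_time_eq)
        finally show False using C by simp
      qed
      moreover have "\<not> (\<exists>k<T * Suc N. e < \<bar>sampled_increments X N \<omega> k\<bar>)"
        using elim(1) by force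
      ultimately show ?case
        using 1 unfolding E_def by blast
    qed
  qed
qed

text \<open>Each inequality is obtained with levels perturbed by a multiple of \<open>r j\<close>
  and carried to the limit along increasing events; strict inequalities make the unions over
  \<open>j\<close> exact.\<close>

lemma emeasure_less_occupation_time:
  assumes "0 < y" "0 \<le> t"
  shows "emeasure M {\<omega> \<in> space M. ennreal t < drawdown_occupation_time X a y \<omega>}
       = emeasure M {\<omega> \<in> space M. ennreal t < drawdown_time X (a - y) \<omega>}" (is "?C = ?\<sigma>")
proof (rule antisym)
  define r where "r j = 1 / real (Suc j)" for j
  have r: "0 < r j" for j by (simp add: r_def)
  let ?O = "\<lambda>j \<omega>. occupied_times X (a - r j) (y + r j) \<omega> \<inter> {0..<real j}"
  let ?E = "\<lambda>j. {\<omega> \<in> space M. ennreal t < emeasure lborel (?O j \<omega>)}"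
  have "incseq ?E"
  proof (intro incseq_SucI subsetI)
    fix j \<omega> assume \<omega>: "\<omega> \<in> ?E j"
    interpret continuous_path X \<omega> using \<omega> paths by simp
    have "emeasure lborel (?O j \<omega>) \<le> emeasure lborel (?O (Suc j) \<omega>)"
      using incseq_SucD[OF incseq_occupied_times[of a y], of j] occupied_times_measurable
      by (intro emeasure_mono) (auto simp: r_def)
    with \<omega> show "\<omega> \<in> ?E (Suc j)" by auto
  qed
  moreover have "{\<omega> \<in> space M. ennreal t < drawdown_occupation_time X a y \<omega>} = (\<Union>j. ?E j)"
    using continuous_path.drawdown_occupation_time_SUP[OF paths, of _ a y]
    by (auto simp: less_SUP_iff r_def)
  ultimately have "?C = (SUP j. emeasure M (?E j))"
    by (simp add: SUP_emeasure_incseq image_subset_iff)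
  also have "\<dots> \<le> ?\<sigma>"
  proof (rule SUP_least)
    fix j
    \<comment> \<open>With \<open>e = r j / 2\<close> the resulting level is
      \<open>a - y - r j / 2\<close>, which is below \<open>a - y\<close>.\<close>
    have "emeasure M (?E j) \<le> emeasure M {\<omega> \<in> space M. ennreal t < drawdown_time X (a - r j - (y + r j) + 3 * (r j / 2)) \<omega>}"
      using assms r[of j] by (intro emeasure_occupation_le) auto
    also have "\<dots> \<le> ?\<sigma>"
    proof (rule emeasure_mono)
      have "drawdown X s \<omega> < a - y" if "drawdown X s \<omega> < a - r j - (y + r j) + 3 * (r j / 2)" for s \<omega>
        using that r[of j] by linarith
      then show "{\<omega> \<in> space M. ennreal t < drawdown_time X (a - r j - (y + r j) + 3 * (r j / 2)) \<omega>}
          \<subseteq> {\<omega> \<in> space M. ennreal t < drawdown_time X (a - y) \<omega>}"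
        using less_drawdown_time_iff[OF _ assms(2)] by blast
    qed measurable
    finally show "emeasure M (?E j) \<le> ?\<sigma>" .
  qed
  finally show "?C \<le> ?\<sigma>" .

  let ?F = "\<lambda>T::nat. {\<omega> \<in> space M. ennreal t < drawdown_occupation_time X a y \<omega> \<or> ennreal (real T) < drawdown_time X a \<omega>}"
  let ?G = "\<lambda>j. {\<omega> \<in> space M. ennreal t < drawdown_time X (a - y - r j) \<omega>}"
  have "incseq ?G"
  proof (intro incseq_SucI subsetI)
    fix j \<omega> assume \<omega>: "\<omega> \<in> ?G j"
    have "r (Suc j) \<le> r j"
      by (simp add: r_def field_simps)
    then have "drawdown X s \<omega> < a - y - r (Suc j)" if "drawdown X s \<omega> < a - y - r j" for s
      using that by linarith
    then show "\<omega> \<in> ?G (Suc j)"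
      using \<omega> less_drawdown_time_iff[OF _ assms(2)] by blast
  qed
  moreover have "{\<omega> \<in> space M. ennreal t < drawdown_time X (a - y) \<omega>} = (\<Union>j. ?G j)"
  proof (intro equalityI subsetI)
    fix \<omega> assume \<omega>: "\<omega> \<in> {\<omega> \<in> space M. ennreal t < drawdown_time X (a - y) \<omega>}"
    interpret continuous_path X \<omega> using \<omega> paths by simp
    have "\<forall>s\<in>{0..t}. drawdown X s \<omega> < a - y"
      using \<omega> less_drawdown_time_iff[OF assms(2)] by blast
    then obtain e where e: "0 < e" "\<And>s. s \<in> {0..t} \<Longrightarrow> drawdown X s \<omega> < a - y - e"
      using drawdown_less_uniformly assms(2) by blast
    obtain j where j: "r j < e"
      using nat_approx_posE[OF e(1)] unfolding r_def by auto
    have "drawdown X s \<omega> < a - y - r j" if "s \<in> {0..t}" for s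
      using e(2)[OF that] j by linarith
    then show "\<omega> \<in> (\<Union>j. ?G j)"
      using \<omega> less_drawdown_time_iff[OF assms(2)] by blast
  next
    fix \<omega> assume "\<omega> \<in> (\<Union>j. ?G j)"
    then obtain j where \<omega>: "\<omega> \<in> ?G j" by blast
    have "drawdown X s \<omega> < a - y" if "drawdown X s \<omega> < a - y - r j" for s
      using that r[of j] by linarith
    then show "\<omega> \<in> {\<omega> \<in> space M. ennreal t < drawdown_time X (a - y) \<omega>}"
      using \<omega> less_drawdown_time_iff[OF _ assms(2)] by blast
  qed
  ultimately have "?\<sigma> = (SUP j. emeasure M (?G j))"
    by (simp add: SUP_emeasure_incseq image_subset_iff)
  also have "\<dots> \<le> (INF T. emeasure M (?F T))"
  proof (intro SUP_least INF_greatest)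
    fix j T
    show "emeasure M (?G j) \<le> emeasure M (?F T)"
      \<comment> \<open>The choice \<open>e = r j / 4\<close> turns \<open>4 * e\<close> into the
        margin of \<open>?G j\<close>.\<close>
      using le_emeasure_occupation[of "r j / 4" y t a T] assms r[of j] by simp
  qed
  \<comment> \<open>As \<open>T\<close> grows, the extra event shrinks to an infinite drawdown time,
    which is null.\<close>
  also have "\<dots> = emeasure M (\<Inter>T. ?F T)"
  proof (rule INF_emeasure_decseq)
    show "decseq ?F"
      by (rule decseq_SucI) (auto intro: order.strict_trans1[rotated] ennreal_leI)
  qed (auto simp: emeasure_finite)
  also have "\<dots> = ?C"
  proof (rule emeasure_eq_AE)
    show "AE \<omega> in M. \<omega> \<in> (\<Inter>T. ?F T) \<longleftrightarrow> \<omega> \<in> {\<omega> \<in> space M. ennreal t < drawdown_occupation_time X a y \<omega>}"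
      using AE_drawdown_time_finite[of a]
    proof eventually_elim
      case (elim \<omega>)
      then obtain u where u: "drawdown_time X a \<omega> = ennreal u" "0 \<le> u"
        by (cases "drawdown_time X a \<omega>") auto
      obtain T :: nat where "u \<le> real T"
        using real_arch_simple by blast
      then have "\<not> ennreal (real T) < drawdown_time X a \<omega>"
        using u by (simp add: ennreal_leI not_less)
      then show ?case by blast
    qed
  qed measurable
  finally show "?\<sigma> \<le> ?C" .
qed

theorem distr_drawdown_occupation_time:
  assumes "0 < y"
  shows "distr M borel (drawdown_occupation_time X a y) = distr M borel (drawdown_time X (a - y))"
proof (rule borel_ennreal_measure_eqI)
  fix t :: ennreal
  show "emeasure (distr M borel (drawdown_occupation_time X a y)) {t<..}
      = emeasure (distr M borel (drawdown_time X (a - y))) {t<..}"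
  proof (cases t)
    case (real r)
    have "emeasure (distr M borel f) {t<..} = emeasure M {\<omega> \<in> space M. t < f \<omega>}"
      if "f \<in> borel_measurable M" for f
      using that by (subst emeasure_distr) (auto intro!: arg_cong[where f = "emeasure M"])
    then show ?thesis
      using emeasure_less_occupation_time[OF assms real(1)] by (simp add: real(2))
  next
    case top
    moreover have "{top<..} = ({} :: ennreal set)" by auto
    ultimately show ?thesis by simp
  qed
qed (auto intro: prob_space_distr)

end

section \<open>Brownian motion with drift\<close>

text \<open>Independence concerns finite subfamilies only, and every finite set of naturals lies in
  an initial segment.\<close>

lemma (in prob_space) indep_vars_nat_initial_segments:
  fixes X :: "nat \<Rightarrow> 'a \<Rightarrow> 'b"
  assumes "\<And>n. indep_vars M' X {..<n}"
  shows "indep_vars M' X UNIV"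
  unfolding indep_vars_def2
proof
  show "\<forall>i\<in>UNIV. random_variable (M' i) (X i)"
    using assms[unfolded indep_vars_def2] by blast
  show "indep_sets (\<lambda>i. {X i -` A \<inter> space M |A. A \<in> sets (M' i)}) UNIV"
  proof (subst indep_sets_finite_index_sets, intro allI impI)
    fix J :: "nat set" assume "finite J"
    then obtain n where "J \<subseteq> {..<n}"
      using finite_nat_iff_bounded by blast
    then show "indep_sets (\<lambda>i. {X i -` A \<inter> space M |A. A \<in> sets (M' i)}) J"
      using assms[unfolded indep_vars_def2] by (blast intro: indep_sets_mono_index)
  qed
qed

text \<open>The density is strictly positive, so a null half-line would be Lebesgue null, yet it
  contains an interval of length 1.\<close>

lemma emeasure_normal_atMost_pos:
  assumes "0 < \<sigma>"
  shows "0 < emeasure (density lborel (normal_density \<mu> \<sigma>)) {..c}"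
proof (rule ccontr)
  assume "\<not> ?thesis"
  then have "emeasure (density lborel (normal_density \<mu> \<sigma>)) {..c} = 0"
    by simp
  then have "{..c} \<in> null_sets (density lborel (normal_density \<mu> \<sigma>))"
    by (simp add: null_sets_def)
  then have "AE x in lborel. x \<in> {..c} \<longrightarrow> normal_density \<mu> \<sigma> x \<le> 0"
    by (subst (asm) null_sets_density_iff) auto
  then have "AE x in lborel. x \<notin> {..c}"
    by (rule eventually_mono) (use normal_density_pos[OF assms] in \<open>auto simp: not_le[symmetric]\<close>)
  then have "{..c} \<in> null_sets lborel"
    by (subst (asm) AE_iff_null_sets[symmetric]) auto
  moreover have "emeasure lborel {c - 1..c} \<le> emeasure lborel {..c}"
    by (intro emeasure_mono) auto
  ultimately show False by (simp add: null_sets_def)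
qed

text \<open>The increment over any cell is the same affine image of a centred normal variable of
  variance \<open>1 / real (Suc N)\<close>; independence is that of the increments of
  \<open>B\<close> along the grid.\<close>

lemma drifted_brownian_motion_iid_increments:
  assumes B: "standard_brownian_motion M B" and "\<sigma> > 0"
    and X: "\<And>t \<omega>. 0 \<le> t \<Longrightarrow> \<omega> \<in> space M \<Longrightarrow> X t \<omega> = x + \<mu> * t + \<sigma> * B t \<omega>"
  shows "continuous_iid_increments M X"
proof -
  have M: "prob_space M" and B_meas: "\<And>t. 0 \<le> t \<Longrightarrow> B t \<in> borel_measurable M"
    and B_indep: "\<And>n t. 0 \<le> t 0 \<Longrightarrow> (\<And>i. t i < t (Suc i)) \<Longrightarrow>
        prob_space.indep_vars M (\<lambda>_. borel) (\<lambda>i \<omega>. B (t (Suc i)) \<omega> - B (t i) \<omega>) {..<n::nat}"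
    and B_normal: "\<And>s t. 0 \<le> s \<Longrightarrow> s < t \<Longrightarrow> distributed M lborel (\<lambda>\<omega>. B t \<omega> - B s \<omega>) (normal_density 0 (sqrt (t - s)))"
    and B_cont: "\<And>\<omega>. \<omega> \<in> space M \<Longrightarrow> continuous_on {0..} (\<lambda>t. B t \<omega>)"
    using B unfolding standard_brownian_motion_def by auto
  interpret prob_space M by fact
  define b where "b N i \<omega> = B (real (Suc i) / real (Suc N)) \<omega> - B (real i / real (Suc N)) \<omega>" for N i \<omega>
  have b_meas [measurable]: "b N i \<in> borel_measurable M" for N i
    unfolding b_def[abs_def] by (intro borel_measurable_diff B_meas) auto
  have b_distr: "distr M lborel (b N i) = density lborel (normal_density 0 (sqrt (1 / real (Suc N))))" for N i
  proof -
    have "real (Suc i) / real (Suc N) - real i / real (Suc N) = 1 / real (Suc N)"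
      by (simp add: diff_divide_distrib[symmetric])
    moreover have "real i / real (Suc N) < real (Suc i) / real (Suc N)"
      by (intro divide_strict_right_mono) auto
    ultimately have "distributed M lborel (b N i) (normal_density 0 (sqrt (1 / real (Suc N))))"
      unfolding b_def[abs_def]
      using B_normal[of "real i / real (Suc N)" "real (Suc i) / real (Suc N)"] by simp
    then show ?thesis by (rule distributed_distr_eq_density)
  qed
  let ?f = "\<lambda>N z. \<mu> / real (Suc N) + \<sigma> * z"
  have X_b: "sampled_increments X N \<omega> i = ?f N (b N i \<omega>)" if "\<omega> \<in> space M" for N i \<omega>
    using that by (simp add: sampled_increments_def b_def X algebra_simps add_divide_distrib)
  show ?thesis
  proof (intro continuous_iid_increments.intro continuous_iid_increments_axioms.intro)
    show "prob_space M" by fact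
  next
    fix \<omega> assume \<omega>: "\<omega> \<in> space M"
    have "continuous_on {0..} (\<lambda>t. x + \<mu> * t + \<sigma> * B t \<omega>)"
      by (intro continuous_intros B_cont \<omega>)
    also have "?this \<longleftrightarrow> continuous_on {0..} (\<lambda>t. X t \<omega>)"
      by (rule continuous_on_cong) (auto simp: X \<omega>)
    finally show "continuous_path X \<omega>"
      by (rule continuous_path.intro)
  next
    fix t :: real assume "0 \<le> t"
    have "(\<lambda>\<omega>. x + \<mu> * t + \<sigma> * B t \<omega>) \<in> borel_measurable M"
      using B_meas[OF \<open>0 \<le> t\<close>] by measurable
    also have "?this \<longleftrightarrow> X t \<in> borel_measurable M"
      by (rule measurable_cong) (simp add: X \<open>0 \<le> t\<close>)
    finally show "X t \<in> borel_measurable M" .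
  next
    fix N
    define Q where "Q = distr (density lborel (normal_density 0 (sqrt (1 / real (Suc N))))) borel (?f N)"
    have Q: "distr M borel (\<lambda>\<omega>. ?f N (b N i \<omega>)) = Q" for i
    proof -
      have "Q = distr (distr M lborel (b N i)) borel (?f N)"
        unfolding Q_def b_distr ..
      also have "\<dots> = distr M borel (?f N \<circ> b N i)"
        by (rule distr_distr) auto
      finally show ?thesis by (simp add: comp_def)
    qed
    have "prob_space Q"
      unfolding Q[of 0, symmetric] by (rule prob_space_distr) measurable
    then interpret Q: prob_space Q .
    have "real_sequence_space Q"
      by unfold_locales (simp add: Q_def)
    moreover have "distr M (\<Pi>\<^sub>M i\<in>UNIV. borel) (sampled_increments X N) = (\<Pi>\<^sub>M i\<in>UNIV. Q)"
    proof -
      have "indep_vars (\<lambda>_. borel) (b N) {..<n}" for n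
        unfolding b_def[abs_def] by (rule B_indep) (auto intro: divide_strict_right_mono)
      then have "indep_vars (\<lambda>_. borel) (b N) UNIV"
        by (rule indep_vars_nat_initial_segments)
      then have "indep_vars (\<lambda>_. borel) (\<lambda>i \<omega>. ?f N (b N i \<omega>)) UNIV"
        by (rule indep_vars_compose2) measurable
      then have "distr M (\<Pi>\<^sub>M i\<in>UNIV. borel) (\<lambda>\<omega> i. ?f N (b N i \<omega>)) = (\<Pi>\<^sub>M i\<in>UNIV. Q)"
        by (subst (asm) indep_vars_iff_distr_eq_PiM) (auto simp: Q restrict_UNIV simp del: of_nat_Suc)
      moreover have "distr M (\<Pi>\<^sub>M i\<in>UNIV. borel) (\<lambda>\<omega> i. ?f N (b N i \<omega>))
          = distr M (\<Pi>\<^sub>M i\<in>UNIV. borel) (sampled_increments X N)"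
        by (intro distr_cong refl) (auto simp: X_b)
      ultimately show ?thesis by simp
    qed
    ultimately show "\<exists>Q. real_sequence_space Q \<and>
        distr M (\<Pi>\<^sub>M i\<in>UNIV. borel) (sampled_increments X N) = (\<Pi>\<^sub>M i\<in>UNIV. Q)"
      by blast
  next
    fix c :: real
    \<comment> \<open>The increment over the first unit of time is
      \<open>\<mu> + \<sigma> * b 0 0 \<omega>\<close>, so it is at most \<open>c\<close> exactly
      when \<open>b 0 0 \<omega>\<close> is at most \<open>?d\<close>.\<close>
    let ?d = "(c - \<mu>) / \<sigma>"
    have "{\<omega> \<in> space M. c < sampled_increments X 0 \<omega> 0} = space M - (b 0 0 -` {..?d} \<inter> space M)"
      using \<open>\<sigma> > 0\<close> by (auto simp: X_b field_simps)
    moreover have "0 < emeasure M (b 0 0 -` {..?d} \<inter> space M)"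
    proof -
      have "emeasure M (b 0 0 -` {..?d} \<inter> space M) = emeasure (distr M lborel (b 0 0)) {..?d}"
        by (subst emeasure_distr) auto
      then show ?thesis
        unfolding b_distr using emeasure_normal_atMost_pos[of "sqrt (1 / real (Suc 0))"] by simp
    qed
    ultimately show "emeasure M {\<omega> \<in> space M. c < sampled_increments X 0 \<omega> 0} < 1"
      by (simp add: emeasure_eq_measure prob_compl ennreal_less_one_iff)
  qed
qed

text \<open>The measurability claims ensure that both \<open>distr\<close> terms are genuine image
  laws.\<close>

theorem corollary6p2:
  fixes M :: "'a measure" and B X :: "real \<Rightarrow> 'a \<Rightarrow> real" and \<mu> \<sigma> x a y :: real
  assumes "\<mu> \<noteq> 0" and "\<sigma> > 0"
    and "standard_brownian_motion M B"
    and "\<And>t \<omega>. 0 \<le> t \<Longrightarrow> \<omega> \<in> space M \<Longrightarrow> X t \<omega> = x + \<mu> * t + \<sigma> * B t \<omega>"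
    and "a > 0" and "0 < y" and "y < a"
  shows "drawdown_occupation_time X a y \<in> borel_measurable M \<and>
         drawdown_time X (a - y) \<in> borel_measurable M \<and>
         distr M borel (drawdown_occupation_time X a y) = distr M borel (drawdown_time X (a - y))"
proof -
  interpret continuous_iid_increments M X
    using assms(2-4) by (intro drifted_brownian_motion_iid_increments)
  show ?thesis
    using distr_drawdown_occupation_time[OF \<open>0 < y\<close>] by simp
qed

end
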